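(* Let $(\mu_k)_{k\in\mathbb N}$ be an equipartition-consistent random graph model, with $\mu_k$ a probability measure on $\Delta^{k\times k}$. Then there exists a unique random exchangeable probability measure $\mathsf M$ on $[0,1]^2$ such that $\mathrm{Law}(\mathsf G_k[\mathsf M])=\mu_k$ for all $k\in\mathbb N$.
   Context: $\Delta^{k\times k}$: $k\times k$ nonnegative matrices with entries summing to $1$. For $f:[m]\to[k]$ and $G\in\mathbb R^{m\times m}$, $(\rho(f)G)_{i,j}=\sum_{v\in f^{-1}(i),u\in f^{-1}(j)}G_{v,u}$. An equipartition is a map $d:[nk]\to[k]$ all of whose fibers have size $n$. A sequence of probability measures $(\mu_k)$ on $\Delta^{k\times k}$ is an equipartition-consistent random graph model if for all $k,n\in\mathbb N$ and every equipartition $d:[nk]\to[k]$, $X\sim\mu_{nk}$ implies $\rho(d)X\sim\mu_k$. A random probability measure $\mathsf M$ on $[0,1]^2$ is exchangeable if $\mathsf M$ and its pushforward under $(x,y)\mapsto(\sigma(x),\sigma(y))$ are equal in distribution for every Lebesgue-measure-preserving bijection $\sigma:[0,1]\to[0,1]$. $\mathsf G_k[\mathsf M]$ is the random $k\times k$ matrix with entries $\mathsf M(I_i^{(k)}\times I_j^{(k)})$, $I_i^{(k)}=[(i-1)/k,i/k)$. *)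

theory Defs
  imports "HOL-Probability.Probability"
begin

text \<open>Index set of a k x k matrix (0-based indices, i.e. [k] = {0,...,k-1}).\<close>
definition grid :: "nat \<Rightarrow> (nat \<times> nat) set" where
  "grid k = {..<k} \<times> {..<k}"

definition MatSpace :: "nat \<Rightarrow> (nat \<times> nat \<Rightarrow> real) measure" where
  "MatSpace k = PiM (grid k) (\<lambda>_. borel)"

definition Delta :: "nat \<Rightarrow> (nat \<times> nat \<Rightarrow> real) set" where
  "Delta k = {G \<in> space (MatSpace k). (\<forall>p\<in>grid k. 0 \<le> G p) \<and> (\<Sum>p\<in>grid k. G p) = 1}"

definition prob_on_Delta :: "nat \<Rightarrow> (nat \<times> nat \<Rightarrow> real) measure \<Rightarrow> bool" where
  "prob_on_Delta k P \<longleftrightarrow> prob_space P \<and> sets P = sets (MatSpace k) \<and> emeasure P (Delta k) = 1"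

definition rho :: "nat \<Rightarrow> nat \<Rightarrow> (nat \<Rightarrow> nat) \<Rightarrow> (nat \<times> nat \<Rightarrow> real) \<Rightarrow> (nat \<times> nat \<Rightarrow> real)" where
  "rho m k f G = (\<lambda>p\<in>grid k.
     (\<Sum>v\<in>{v\<in>{..<m}. f v = fst p}. \<Sum>u\<in>{u\<in>{..<m}. f u = snd p}. G (v, u)))"

definition equipartition :: "nat \<Rightarrow> nat \<Rightarrow> (nat \<Rightarrow> nat) \<Rightarrow> bool" where
  "equipartition n k d \<longleftrightarrow> d \<in> {..<n*k} \<rightarrow> {..<k} \<and>
     (\<forall>i<k. card {v\<in>{..<n*k}. d v = i} = n)"

text \<open>Equipartition-consistent random graph model (indices k \<ge> 1; mu 0 is irrelevant).\<close>
definition equipartition_consistent :: "(nat \<Rightarrow> (nat \<times> nat \<Rightarrow> real) measure) \<Rightarrow> bool" where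
  "equipartition_consistent \<mu> \<longleftrightarrow>
     (\<forall>k\<ge>1. prob_on_Delta k (\<mu> k)) \<and>
     (\<forall>k\<ge>1. \<forall>n\<ge>1. \<forall>d. equipartition n k d \<longrightarrow>
        distr (\<mu> (n*k)) (MatSpace k) (rho (n*k) k d) = \<mu> k)"

definition Sq :: "(real \<times> real) measure" where
  "Sq = restrict_space borel ({0..1} \<times> {0..1})"

definition Leb01 :: "real measure" where
  "Leb01 = restrict_space lborel {0..1}"

definition mp_bij :: "(real \<Rightarrow> real) \<Rightarrow> bool" where
  "mp_bij \<sigma> \<longleftrightarrow> bij_betw \<sigma> {0..1} {0..1} \<and> \<sigma> \<in> measurable Leb01 Leb01 \<and>
     distr Leb01 Leb01 \<sigma> = Leb01"

text \<open>A random probability measure on [0,1]^2 is described by its law, a probability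
  measure on the Giry space of probability measures on [0,1]^2.  It is exchangeable iff its
  law is invariant under pushing forward by (x,y) |-> (sigma x, sigma y).\<close>
definition exchangeable_law :: "(real \<times> real) measure measure \<Rightarrow> bool" where
  "exchangeable_law P \<longleftrightarrow>
     (\<forall>\<sigma>. mp_bij \<sigma> \<longrightarrow>
        distr P (prob_algebra Sq) (\<lambda>m. distr m Sq (\<lambda>(x, y). (\<sigma> x, \<sigma> y))) = P)"

text \<open>Interval I_i^{(k)} = [(i-1)/k, i/k), written 0-based as [i/k, (i+1)/k).\<close>
definition Ik :: "nat \<Rightarrow> nat \<Rightarrow> real set" where
  "Ik k i = {real i / real k ..< (real i + 1) / real k}"

definition Gk :: "nat \<Rightarrow> (real \<times> real) measure \<Rightarrow> (nat \<times> nat \<Rightarrow> real)" where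
  "Gk k M = (\<lambda>p\<in>grid k. measure M (Ik k (fst p) \<times> Ik k (snd p)))"

end

theory Submission
  imports Defs
begin

text \<open>
  Existence: consistency along the block maps between the levels \<open>n!\<close> and Kolmogorov's extension theorem
  give a random consistent family of matrices.  By exchangeability every row and column carries expected
  mass \<open>1/k\<close>, so almost surely no mass escapes to the grid lines and the family is the family of cell
  masses of a measure, itself obtained from Kolmogorov's theorem as the law of the point in which a random
  nested sequence of cells shrinks.

  Exchangeability: the expected margins of the random measure are Lebesgue measure.  Hence the preimages of
  the intervals under a measure preserving map, being approximable by unions of cells forming an
  equipartition, give a random matrix that is an \<open>L\<^sup>1\<close> limit of matrices with law \<open>\<mu> k\<close>.

  Uniqueness: the cell masses at all levels \<open>n!\<close> determine a measure concentrated on \<open>[0,1)\<^sup>2\<close>, and the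
  levels are directed, so the laws of the matrices determine the law of the measure.
\<close>

subsection \<open>Sigma-algebras generated by refining maps\<close>

definition cylinders :: "'a set \<Rightarrow> ('i \<Rightarrow> 'b measure) \<Rightarrow> ('i \<Rightarrow> 'a \<Rightarrow> 'b) \<Rightarrow> 'a set set" where
  "cylinders \<Omega> N f = {f n -` A \<inter> \<Omega> | n A. A \<in> sets (N n)}"

lemma cylinders_subset_Pow: "cylinders \<Omega> N f \<subseteq> Pow \<Omega>"
  by (auto simp: cylinders_def)

lemma Int_stable_cylinders:
  fixes f :: "'i::linorder \<Rightarrow> 'a \<Rightarrow> 'b"
  assumes range: "\<And>n x. x \<in> \<Omega> \<Longrightarrow> f n x \<in> space (N n)"
    and factor: "\<And>n m. n \<le> m \<Longrightarrow> \<exists>g\<in>measurable (N m) (N n). \<forall>x\<in>\<Omega>. f n x = g (f m x)"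
  shows "Int_stable (cylinders \<Omega> N f)"
proof (rule Int_stableI)
  fix X X' assume "X \<in> cylinders \<Omega> N f" "X' \<in> cylinders \<Omega> N f"
  then obtain n A n' A' where X: "X = f n -` A \<inter> \<Omega>" "A \<in> sets (N n)"
    and X': "X' = f n' -` A' \<inter> \<Omega>" "A' \<in> sets (N n')"
    unfolding cylinders_def by blast
  have refine: "\<exists>B\<in>sets (N m). f i -` C \<inter> \<Omega> = f m -` B \<inter> \<Omega>"
    if "i \<le> m" "C \<in> sets (N i)" for i m C
  proof -
    obtain g where g: "g \<in> measurable (N m) (N i)" "\<And>x. x \<in> \<Omega> \<Longrightarrow> f i x = g (f m x)"
      using factor[OF \<open>i \<le> m\<close>] by blast
    then have "f i -` C \<inter> \<Omega> = f m -` (g -` C \<inter> space (N m)) \<inter> \<Omega>"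
      using range by auto
    with measurable_sets[OF g(1) that(2)] show ?thesis by blast
  qed
  let ?m = "max n n'"
  obtain B B' where "B \<in> sets (N ?m)" "X = f ?m -` B \<inter> \<Omega>" "B' \<in> sets (N ?m)" "X' = f ?m -` B' \<inter> \<Omega>"
    using refine[OF max.cobounded1 X(2), of n'] refine[OF max.cobounded2 X'(2), of n] X(1) X'(1) by auto
  then have "X \<inter> X' = f ?m -` (B \<inter> B') \<inter> \<Omega>" "B \<inter> B' \<in> sets (N ?m)" by auto
  then show "X \<inter> X' \<in> cylinders \<Omega> N f" unfolding cylinders_def by blast
qed

lemma measurable_sigma_cylinders:
  assumes "\<And>x. x \<in> \<Omega> \<Longrightarrow> f n x \<in> space (N n)"
  shows "f n \<in> measurable (sigma \<Omega> (cylinders \<Omega> N f)) (N n)"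
proof (rule measurableI)
  fix A assume "A \<in> sets (N n)"
  then have "f n -` A \<inter> \<Omega> \<in> cylinders \<Omega> N f" unfolding cylinders_def by blast
  then show "f n -` A \<inter> space (sigma \<Omega> (cylinders \<Omega> N f)) \<in> sets (sigma \<Omega> (cylinders \<Omega> N f))"
    by (simp add: space_measure_of_conv cylinders_subset_Pow sigma_sets.Basic)
qed (use assms in \<open>simp add: space_measure_of_conv\<close>)

lemma sets_eqI_measurable_ident:
  assumes "(\<lambda>x. x) \<in> measurable M N" "(\<lambda>x. x) \<in> measurable N M"
  shows "sets M = sets N"
proof -
  have "sets M \<subseteq> sets N" if "(\<lambda>x. x) \<in> measurable M N" "(\<lambda>x. x) \<in> measurable N M" for M N :: "'a measure"
  proof
    fix A assume A: "A \<in> sets M"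
    then have "A \<inter> space N = A"
      using sets.sets_into_space[OF A] measurable_space[OF that(1)] by auto
    with measurable_sets[OF that(2) A] show "A \<in> sets N" by simp
  qed
  with assms show ?thesis by blast
qed

lemma sets_eq_sigma_cylindersI:
  assumes space: "space M = \<Omega>" and f: "\<And>n. f n \<in> measurable M (N n)"
    and ident: "(\<lambda>x. x) \<in> measurable (sigma \<Omega> (cylinders \<Omega> N f)) M"
  shows "sets M = sigma_sets \<Omega> (cylinders \<Omega> N f)"
proof -
  have "(\<lambda>x. x) \<in> measurable M (sigma \<Omega> (cylinders \<Omega> N f))"
    using measurable_sets[OF f] space
    by (intro measurable_measure_of) (auto simp: cylinders_def)
  from sets_eqI_measurable_ident[OF this ident] show ?thesis
    by (simp add: cylinders_subset_Pow)
qed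

lemma sets_restrict_borel_eq_sigma_cylinders:
  fixes f :: "nat \<Rightarrow> 'a::metric_space \<Rightarrow> 'a"
  assumes f: "\<And>n. f n \<in> borel_measurable (restrict_space borel \<Omega>)"
    and lim: "\<And>x. x \<in> \<Omega> \<Longrightarrow> (\<lambda>n. f n x) \<longlonglongrightarrow> x"
  shows "sets (restrict_space borel \<Omega>) = sigma_sets \<Omega> (cylinders \<Omega> (\<lambda>_. borel) f)"
proof (rule sets_eq_sigma_cylindersI[OF _ f])
  have "(\<lambda>x. x) \<in> borel_measurable (sigma \<Omega> (cylinders \<Omega> (\<lambda>_. borel) f))"
    by (rule borel_measurable_LIMSEQ_metric[where f = f])
      (use lim measurable_sigma_cylinders[of \<Omega> f _ "\<lambda>_. borel"] in \<open>auto simp: space_measure_of_conv\<close>)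
  then show "(\<lambda>x. x) \<in> measurable (sigma \<Omega> (cylinders \<Omega> (\<lambda>_. borel) f)) (restrict_space borel \<Omega>)"
    by (intro measurable_restrict_space2) (auto simp: space_measure_of_conv)
qed (simp add: space_restrict_space)

lemma measure_eqI_cylinders:
  fixes f :: "nat \<Rightarrow> 'a \<Rightarrow> 'b"
  assumes P: "finite_measure P" and sets: "sets P = sets Q" and \<Omega>: "\<Omega> \<in> sets P"
    and concentrated: "AE x in P. x \<in> \<Omega>" "AE x in Q. x \<in> \<Omega>"
    and generator: "sets (restrict_space P \<Omega>) = sigma_sets \<Omega> (cylinders \<Omega> N f)"
    and factor: "\<And>n m. n \<le> m \<Longrightarrow> \<exists>g\<in>measurable (N m) (N n). \<forall>x\<in>\<Omega>. f n x = g (f m x)"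
    and f: "\<And>n. f n \<in> measurable P (N n)"
    and distr_eq: "\<And>n. distr P (N n) (f n) = distr Q (N n) (f n)"
  shows "P = Q"
proof (rule measure_eqI_restrict_generator)
  have range: "f n x \<in> space (N n)" if "x \<in> \<Omega>" for n x
    using that sets.sets_into_space[OF \<Omega>] measurable_space[OF f] by blast
  show "Int_stable (cylinders \<Omega> N f)" by (rule Int_stable_cylinders[OF range factor])
  show "cylinders \<Omega> N f \<subseteq> Pow \<Omega>" by (rule cylinders_subset_Pow)
  show "sets (restrict_space Q \<Omega>) = sigma_sets \<Omega> (cylinders \<Omega> N f)"
    using generator sets_restrict_space_cong[OF sets] by simp
  have cylinder: "emeasure R (f n -` A \<inter> \<Omega>) = emeasure (distr R (N n) (f n)) A"
    if R: "sets R = sets P" "AE x in R. x \<in> \<Omega>" and A: "A \<in> sets (N n)" for R n A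
  proof -
    have f_R: "f n \<in> measurable R (N n)" using f by (simp cong: measurable_cong_sets add: R)
    have "f n -` A \<inter> \<Omega> = (f n -` A \<inter> space R) \<inter> \<Omega>"
      using sets.sets_into_space[OF \<Omega>] sets_eq_imp_space_eq[OF R(1)] by auto
    also have "emeasure R \<dots> = emeasure R (f n -` A \<inter> space R)"
      using R(2) measurable_sets[OF f_R A] \<Omega> R(1) by (intro emeasure_eq_AE) auto
    finally show ?thesis by (simp add: emeasure_distr[OF f_R A])
  qed
  show "emeasure P X = emeasure Q X" if "X \<in> cylinders \<Omega> N f" for X
    using that unfolding cylinders_def by (auto simp: cylinder concentrated sets distr_eq)
  have "\<Omega> = f 0 -` space (N 0) \<inter> \<Omega>" using range by auto
  then show "{\<Omega>} \<subseteq> cylinders \<Omega> N f" unfolding cylinders_def by blast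
  show "emeasure P a \<noteq> \<infinity>" if "a \<in> {\<Omega>}" for a
    using finite_measure.emeasure_finite[OF P] by simp
qed (use sets \<Omega> concentrated generator in auto)

subsection \<open>Inverse limits\<close>

lemma measurable_component_UNIV:
  assumes "sets L = sets (PiM UNIV (\<lambda>_. N))" shows "(\<lambda>x. x i) \<in> measurable L N"
  using measurable_component_singleton[of i UNIV "\<lambda>_. N"] by (simp cong: measurable_cong_sets add: assms)

locale inverse_system =
  fixes \<nu> :: "nat \<Rightarrow> 'a::polish_space measure" and f :: "nat \<Rightarrow> nat \<Rightarrow> 'a \<Rightarrow> 'a"
  assumes prob_space_\<nu>: "prob_space (\<nu> n)"
    and sets_\<nu> [measurable_cong, simp]: "sets (\<nu> n) = sets borel"
    and measurable_f: "n \<le> m \<Longrightarrow> f n m \<in> borel_measurable borel"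
    and f_f: "n \<le> m \<Longrightarrow> m \<le> k \<Longrightarrow> f n m (f m k x) = f n k x"
    and distr_f: "n \<le> m \<Longrightarrow> distr (\<nu> m) borel (f n m) = \<nu> n"
begin

definition marginal :: "nat set \<Rightarrow> (nat \<Rightarrow> 'a) measure" where
  "marginal J = distr (\<nu> (Max (insert 0 J))) (PiM J (\<lambda>_. borel)) (\<lambda>x. \<lambda>n\<in>J. f n (Max (insert 0 J)) x)"

lemma measurable_restrict_f:
  assumes "\<And>n. n \<in> J \<Longrightarrow> n \<le> m"
  shows "(\<lambda>x. \<lambda>n\<in>J. f n m x) \<in> measurable (\<nu> k) (PiM J (\<lambda>_. borel))"
proof -
  have "(\<lambda>x. \<lambda>n\<in>J. f n m x) \<in> measurable borel (PiM J (\<lambda>_. borel))"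
    using assms by (intro measurable_restrict measurable_f)
  then show ?thesis by (simp cong: measurable_cong_sets)
qed

lemma marginal_eq_distr:
  assumes J: "finite J" and bound: "\<And>n. n \<in> J \<Longrightarrow> n \<le> m"
  shows "marginal J = distr (\<nu> m) (PiM J (\<lambda>_. borel)) (\<lambda>x. \<lambda>n\<in>J. f n m x)"
proof -
  define k where "k = Max (insert 0 J)"
  have le_k: "n \<le> k" if "n \<in> J" for n using that J by (simp add: k_def)
  have "k \<le> m" using J bound by (simp add: k_def)
  have "marginal J = distr (distr (\<nu> m) borel (f k m)) (PiM J (\<lambda>_. borel)) (\<lambda>x. \<lambda>n\<in>J. f n k x)"
    by (simp add: marginal_def distr_f[OF \<open>k \<le> m\<close>] flip: k_def)
  also have "\<dots> = distr (\<nu> m) (PiM J (\<lambda>_. borel)) ((\<lambda>x. \<lambda>n\<in>J. f n k x) \<circ> f k m)"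
    using measurable_restrict_f[OF le_k, of J] measurable_f[OF \<open>k \<le> m\<close>]
    by (intro distr_distr) (auto cong: measurable_cong_sets)
  also have "(\<lambda>x. \<lambda>n\<in>J. f n k x) \<circ> f k m = (\<lambda>x. \<lambda>n\<in>J. f n m x)"
    by (auto simp: fun_eq_iff f_f le_k \<open>k \<le> m\<close>)
  finally show ?thesis .
qed

lemma projective_family_marginal: "projective_family UNIV marginal (\<lambda>_. borel)"
proof (rule projective_family.intro)
  fix J H :: "nat set" assume JH: "J \<subseteq> H" "finite H"
  define m where "m = Max (insert 0 H)"
  have m: "n \<le> m" if "n \<in> H" for n using that JH by (simp add: m_def)
  have "marginal J = distr (\<nu> m) (PiM J (\<lambda>_. borel)) ((\<lambda>g. restrict g J) \<circ> (\<lambda>x. \<lambda>n\<in>H. f n m x))"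
    using JH m by (subst marginal_eq_distr[of _ m])
      (auto intro: finite_subset intro!: distr_cong simp: fun_eq_iff restrict_def)
  also have "\<dots> = distr (marginal H) (PiM J (\<lambda>_. borel)) (\<lambda>g. restrict g J)"
    using JH m by (subst marginal_eq_distr[of H m])
      (auto intro!: distr_distr[symmetric] measurable_restrict_subset measurable_restrict_f)
  finally show "marginal J = distr (marginal H) (PiM J (\<lambda>_. borel)) (\<lambda>g. restrict g J)" .
next
  show "prob_space (marginal J)" if "finite J" for J
    unfolding marginal_def using that
    by (intro prob_space.prob_space_distr[OF prob_space_\<nu>] measurable_restrict_f) simp
qed

sublocale polish_projective UNIV marginal
  by (rule polish_projective.intro[OF projective_family_marginal])

lemma measurable_restrict_lim: "(\<lambda>x. restrict x J) \<in> measurable lim (PiM J (\<lambda>_. borel))"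
  by (simp cong: measurable_cong_sets add: measurable_restrict_subset)

lemma distr_lim_restrict:
  assumes J: "finite J"
  shows "distr lim (PiM J (\<lambda>_. borel)) (\<lambda>x. restrict x J) = marginal J"
proof (rule measure_eqI)
  fix A assume "A \<in> sets (distr lim (PiM J (\<lambda>_. borel)) (\<lambda>x. restrict x J))"
  then have A: "A \<in> sets (PiM J (\<lambda>_. borel))" by simp
  have "emeasure (distr lim (PiM J (\<lambda>_. borel)) (\<lambda>x. restrict x J)) A
      = emeasure lim (prod_emb UNIV (\<lambda>_. borel) J A)"
    using measurable_restrict_lim A by (subst emeasure_distr) (auto simp: prod_emb_def space_PiM)
  also have "\<dots> = emeasure (marginal J) A"
    using J A by (intro emeasure_lim_emb) auto
  finally show "emeasure (distr lim (PiM J (\<lambda>_. borel)) (\<lambda>x. restrict x J)) A = emeasure (marginal J) A" .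
qed (simp add: marginal_def)

lemma distr_lim_component: "distr lim borel (\<lambda>x. x n) = \<nu> n"
proof -
  have "distr lim borel (\<lambda>x. x n) = distr (marginal {n}) borel (\<lambda>x. x n)"
    unfolding distr_lim_restrict[OF finite.intros(2)[OF finite.emptyI, of n], symmetric]
    by (subst distr_distr[OF _ measurable_restrict_lim]) (auto simp: comp_def)
  also have "marginal {n} = distr (\<nu> n) (PiM {n} (\<lambda>_. borel)) (\<lambda>x. \<lambda>i\<in>{n}. f i n x)"
    by (rule marginal_eq_distr) auto
  also have "distr \<dots> borel (\<lambda>x. x n) = distr (\<nu> n) borel (f n n)"
    by (subst distr_distr[OF _ measurable_restrict_f]) (auto simp: comp_def)
  finally show ?thesis by (simp add: distr_f)
qed

lemma AE_lim_consistent: "AE x in lim. \<forall>n m. n \<le> m \<longrightarrow> x n = f n m (x m)"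
proof -
  have "AE x in lim. x n = f n m (x m)" if "n \<le> m" for n m
  proof -
    let ?J = "{n, m}"
    have [measurable]: "f n m \<in> borel_measurable borel" by (rule measurable_f[OF that])
    have "marginal ?J = distr (\<nu> m) (PiM ?J (\<lambda>_. borel)) (\<lambda>x. \<lambda>i\<in>?J. f i m x)"
      using that by (intro marginal_eq_distr) auto
    moreover have "AE x in \<dots>. x n = f n m (x m)"
      using that by (subst AE_distr_iff) (auto intro!: measurable_restrict_f simp: f_f)
    ultimately have "AE x in marginal ?J. x n = f n m (x m)" by (simp only:)
    then have "AE x in distr lim (PiM ?J (\<lambda>_. borel)) (\<lambda>x. restrict x ?J). x n = f n m (x m)"
      by (simp only: distr_lim_restrict finite_insert finite.emptyI)
    then show ?thesis by (subst (asm) AE_distr_iff[OF measurable_restrict_lim]) auto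
  qed
  then show ?thesis by (simp add: AE_all_countable)
qed

end

lemma measurable_discrete:
  fixes g :: "'a::countable discrete \<Rightarrow> 'b"
  assumes "\<And>x. g x \<in> space N"
  shows "g \<in> measurable borel N"
  using assms by (intro measurableI) (auto simp: sets_borel_eq_count_space)

lemma pmf_inverse_limit:
  fixes p :: "nat \<Rightarrow> 'a::countable pmf"
  assumes f_f: "\<And>n m k x. n \<le> m \<Longrightarrow> m \<le> k \<Longrightarrow> f n m (f m k x) = f n k x"
    and map_f: "\<And>n m. n \<le> m \<Longrightarrow> map_pmf (f n m) (p m) = p n"
  obtains L where "prob_space L" "sets L = sets (PiM UNIV (\<lambda>_. count_space UNIV))"
    "\<And>n. distr L (count_space UNIV) (\<lambda>x. x n) = measure_pmf (p n)"
    "AE x in L. \<forall>n m. n \<le> m \<longrightarrow> x n = f n m (x m)"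
proof -
  \<comment> \<open>\<open>polish_projective\<close> needs a Polish state space, so the values get the discrete topology.\<close>
  let ?d = "discrete :: 'a \<Rightarrow> 'a discrete"
  define \<nu> where "\<nu> n = distr (p n) borel ?d" for n
  define F where "F n m x = ?d (f n m (of_discrete x))" for n m x
  have [simp]: "of_discrete (?d x) = x" for x by (simp add: discrete_inverse)
  interpret inverse_system \<nu> F
  proof (rule inverse_system.intro)
    show "prob_space (\<nu> n)" for n
      unfolding \<nu>_def by (intro measure_pmf.prob_space_distr) simp
    show "distr (\<nu> m) borel (F n m) = \<nu> n" if "n \<le> m" for n m
      unfolding \<nu>_def map_f[OF that, symmetric] map_pmf_rep_eq
      by (subst distr_distr[OF measurable_discrete], simp, simp, subst distr_distr)
        (simp_all add: comp_def F_def)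
  qed (simp_all add: \<nu>_def F_def f_f measurable_discrete)
  let ?L = "distr lim (PiM UNIV (\<lambda>_. count_space UNIV)) (\<lambda>x n. of_discrete (x n))"
  have measurable_unwrap: "(\<lambda>x n. of_discrete (x n)) \<in> measurable lim (PiM UNIV (\<lambda>_. count_space UNIV))"
    by (intro measurable_PiM_single' measurable_compose[OF measurable_component_UNIV[OF sets_lim] measurable_discrete])
      simp_all
  show ?thesis
  proof
    show "prob_space ?L" by (rule P.prob_space_distr[OF measurable_unwrap])
    show "distr ?L (count_space UNIV) (\<lambda>x. x n) = measure_pmf (p n)" for n
    proof -
      have "distr ?L (count_space UNIV) (\<lambda>x. x n)
          = distr (distr lim borel (\<lambda>x. x n)) (count_space UNIV) of_discrete"
        by (subst distr_distr[OF _ measurable_unwrap], simp,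
            subst distr_distr[OF measurable_discrete measurable_component_UNIV[OF sets_lim]])
          (simp_all add: comp_def)
      also have "\<dots> = distr (p n) (count_space UNIV) (\<lambda>x. x)"
        unfolding distr_lim_component \<nu>_def by (subst distr_distr[OF measurable_discrete]) (simp_all add: comp_def)
      finally show ?thesis by (simp add: map_pmf_rep_eq[symmetric])
    qed
    show "AE x in ?L. \<forall>n m. n \<le> m \<longrightarrow> x n = f n m (x m)"
      using AE_lim_consistent by (subst AE_distr_iff[OF measurable_unwrap]) (auto simp: F_def)
  qed simp
qed

subsection \<open>Laws of limits\<close>

lemma dist_fun_le:
  fixes x y :: "'a::countable \<Rightarrow> 'b::metric_space"
  assumes "\<And>i. dist (x i) (y i) \<le> d"
  shows "dist x y \<le> 2 * d"
proof -
  have "0 \<le> d" using assms[of undefined] zero_le_dist order_trans by blast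
  have sums: "(\<lambda>n. (1/2)^n * d) sums (2 * d)"
    using sums_mult2[OF geometric_sums[of "1/2 :: real"], of d] by simp
  have "dist x y \<le> (\<Sum>n. (1/2)^n * d)"
    unfolding dist_fun_def
  proof (intro suminf_le sums_summable[OF sums])
    show "(1/2)^n * min (dist (x (from_nat n)) (y (from_nat n))) 1 \<le> (1/2)^n * d" for n
      using assms[of "from_nat n"] by (intro mult_left_mono) auto
    show "summable (\<lambda>n. (1/2)^n * min (dist (x (from_nat n)) (y (from_nat n))) 1)"
      by (rule summable_comparison_test'[OF summable_geometric[of "1/2 :: real"], of 0])
        (auto simp: abs_mult)
  qed
  with sums show ?thesis by (simp add: sums_iff)
qed

lemma measure_closed_le_nbhd_if_L1_close:
  fixes Y Z :: "'w \<Rightarrow> 'a::{metric_space, second_countable_topology}"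
  assumes \<Omega>: "prob_space \<Omega>"
    and [measurable]: "Y \<in> borel_measurable \<Omega>" "Z \<in> borel_measurable \<Omega>"
    and C: "closed C" "C \<noteq> {}" and \<eta>: "0 < \<eta>"
    and L1: "(\<integral>\<^sup>+w. dist (Y w) (Z w) \<partial>\<Omega>) \<le> ennreal (\<eta>\<^sup>2)"
  shows "measure (distr \<Omega> borel Y) C \<le> measure (distr \<Omega> borel Z) {x. infdist x C \<le> \<eta>} + \<eta>"
proof -
  interpret prob_space \<Omega> by fact
  have [measurable]: "C \<in> sets borel" using C by simp
  have [measurable]: "(\<lambda>x. infdist x C) \<in> borel_measurable borel"
    by (intro borel_measurable_continuous_onI continuous_intros)
  let ?far = "{w\<in>space \<Omega>. \<eta> \<le> dist (Y w) (Z w)}"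
  have "\<eta> \<le> d \<longleftrightarrow> 1 \<le> ennreal (1 / \<eta>) * ennreal d" for d
    using \<eta> by (subst ennreal_mult'[symmetric]) (auto simp: field_simps ennreal_le_iff2 simp flip: ennreal_1)
  then have "emeasure \<Omega> ?far \<le> ennreal (1 / \<eta>) * (\<integral>\<^sup>+w. ennreal (dist (Y w) (Z w)) * indicator (space \<Omega>) w \<partial>\<Omega>)"
    by (simp only:) (rule nn_integral_Markov_inequality; measurable)
  also have "\<dots> \<le> ennreal (1 / \<eta>) * ennreal (\<eta>\<^sup>2)"
    using L1 by (intro mult_left_mono) (simp_all cong: nn_integral_cong)
  also have "\<dots> = ennreal \<eta>" using \<eta> by (simp add: power2_eq_square flip: ennreal_mult')
  finally have far: "prob ?far \<le> \<eta>" using \<eta> by (simp add: emeasure_eq_measure)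
  have "prob {w\<in>space \<Omega>. Y w \<in> C} \<le> prob ({w\<in>space \<Omega>. infdist (Z w) C \<le> \<eta>} \<union> ?far)"
  proof (rule finite_measure_mono)
    have "infdist (Z w) C \<le> dist (Y w) (Z w)" if "Y w \<in> C" for w
      using infdist_le[OF that, of "Z w"] by (simp add: dist_commute)
    then show "{w\<in>space \<Omega>. Y w \<in> C} \<subseteq> {w\<in>space \<Omega>. infdist (Z w) C \<le> \<eta>} \<union> ?far"
      by (auto simp: not_le) (meson less_imp_le order_trans)
  qed simp
  also have "\<dots> \<le> prob {w\<in>space \<Omega>. infdist (Z w) C \<le> \<eta>} + prob ?far"
    by (rule measure_Un_le) simp_all
  finally show ?thesis
    using far by (simp add: measure_distr vimage_def Int_def conj_commute)
qed

lemma measure_closed_nbhd_tendsto: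
  fixes C :: "'a::metric_space set"
  assumes N: "finite_measure N" "sets N = sets borel" and C: "closed C" "C \<noteq> {}"
  shows "(\<lambda>j. measure N {x. infdist x C \<le> 1 / real (Suc j)}) \<longlonglongrightarrow> measure N C"
proof -
  let ?nbhd = "\<lambda>j. {x. infdist x C \<le> 1 / real (Suc j)}"
  have "closed (?nbhd j)" for j by (intro closed_Collect_le continuous_intros)
  then have nbhd: "range ?nbhd \<subseteq> sets N" by (auto simp: N)
  have "decseq ?nbhd"
    by (intro decseq_SucI Collect_mono impI, erule order_trans) (simp add: field_simps)
  with nbhd have "(\<lambda>j. measure N (?nbhd j)) \<longlonglongrightarrow> measure N (\<Inter>j. ?nbhd j)"
    by (intro finite_measure.finite_Lim_measure_decseq[OF N(1)])
  also have "(\<Inter>j. ?nbhd j) = C"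
  proof (intro equalityI subsetI)
    fix x assume x: "x \<in> (\<Inter>j. ?nbhd j)"
    have "infdist x C \<le> 0"
      by (rule LIMSEQ_le_const[OF LIMSEQ_Suc[OF lim_1_over_n]]) (use x in auto)
    then show "x \<in> C" using C infdist_nonneg[of x C] by (simp add: in_closed_iff_infdist_zero)
  qed (simp add: infdist_zero)
  finally show ?thesis .
qed

lemma measure_closed_le_if_nbhd_le:
  fixes C :: "'a::metric_space set"
  assumes C: "closed C" and N: "finite_measure N" "sets N = sets borel"
    and nbhd: "\<And>\<eta>. 0 < \<eta> \<Longrightarrow> C \<noteq> {} \<Longrightarrow> measure M C \<le> measure N {x. infdist x C \<le> \<eta>} + \<eta>"
  shows "measure M C \<le> measure N C"
proof (cases "C = {}")
  case False
  have "(\<lambda>j. measure N {x. infdist x C \<le> 1 / real (Suc j)} + 1 / real (Suc j)) \<longlonglongrightarrow> measure N C + 0"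
    using N C False by (intro tendsto_add measure_closed_nbhd_tendsto LIMSEQ_Suc[OF lim_1_over_n])
  then have "measure M C \<le> measure N C + 0"
    by (rule LIMSEQ_le_const) (use nbhd[OF _ False] in auto)
  then show ?thesis by simp
qed simp

lemma finite_borel_measure_eqI_closed:
  fixes M N :: "'a::topological_space measure"
  assumes M: "finite_measure M" "sets M = sets borel" and N: "finite_measure N" "sets N = sets borel"
    and closed_eq: "\<And>C. closed C \<Longrightarrow> measure M C = measure N C"
  shows "M = N"
proof (rule measure_eqI_generator_eq[where E = "Collect closed" and \<Omega> = UNIV and A = "\<lambda>_. UNIV"])
  interpret M: finite_measure M by fact
  interpret N: finite_measure N by fact
  show "emeasure M C = emeasure N C" if "C \<in> Collect closed" for C
    using that by (simp add: M.emeasure_eq_measure N.emeasure_eq_measure closed_eq)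
  show "emeasure M UNIV \<noteq> \<infinity>" by simp
  show "Int_stable (Collect closed :: 'a set set)" by (auto intro!: Int_stableI)
  show "sets M = sigma_sets UNIV (Collect closed)" "sets N = sigma_sets UNIV (Collect closed)"
    by (simp_all add: M N borel_eq_closed)
qed auto

lemma distr_eq_if_L1_approx:
  fixes Y :: "'w \<Rightarrow> 'a::{metric_space, second_countable_topology}"
  assumes \<Omega>: "prob_space \<Omega>" and Y: "Y \<in> borel_measurable \<Omega>"
    and approx: "\<And>\<epsilon>. 0 < \<epsilon> \<Longrightarrow> \<exists>Z\<in>borel_measurable \<Omega>. distr \<Omega> borel Z = N \<and>
      (\<integral>\<^sup>+w. dist (Y w) (Z w) \<partial>\<Omega>) \<le> ennreal \<epsilon>"
  shows "distr \<Omega> borel Y = N"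
proof -
  have distr: "finite_measure (distr \<Omega> borel Z)" if "Z \<in> borel_measurable \<Omega>" for Z :: "'w \<Rightarrow> 'a"
    using prob_space.prob_space_distr[OF \<Omega> that] by (simp add: prob_space_def)
  obtain Z\<^sub>1 where "Z\<^sub>1 \<in> borel_measurable \<Omega>" "distr \<Omega> borel Z\<^sub>1 = N"
    using approx[of 1] by auto
  then have N: "finite_measure N" "sets N = sets borel" using distr by auto
  have "measure (distr \<Omega> borel Y) C = measure N C" if C: "closed C" for C
  proof (rule antisym; rule measure_closed_le_if_nbhd_le[OF C])
    fix \<eta> :: real assume \<eta>: "0 < \<eta>" "C \<noteq> {}"
    then obtain Z where Z: "Z \<in> borel_measurable \<Omega>" "distr \<Omega> borel Z = N"
      "(\<integral>\<^sup>+w. dist (Y w) (Z w) \<partial>\<Omega>) \<le> ennreal (\<eta>\<^sup>2)"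
      using approx[of "\<eta>\<^sup>2"] by auto
    then show "measure (distr \<Omega> borel Y) C \<le> measure N {x. infdist x C \<le> \<eta>} + \<eta>"
      using measure_closed_le_nbhd_if_L1_close[OF \<Omega> Y Z(1) C \<eta>(2,1)] by simp
    show "measure N C \<le> measure (distr \<Omega> borel Y) {x. infdist x C \<le> \<eta>} + \<eta>"
      using measure_closed_le_nbhd_if_L1_close[OF \<Omega> Z(1) Y C \<eta>(2,1)] Z(2,3) by (simp add: dist_commute)
  qed (use N distr[OF Y] in auto)
  then show ?thesis by (intro finite_borel_measure_eqI_closed distr[OF Y] N) auto
qed

lemma AE_INF_eq_0:
  fixes f :: "'i \<Rightarrow> 'a \<Rightarrow> ennreal"
  assumes I: "countable I" and [measurable]: "\<And>i. i \<in> I \<Longrightarrow> f i \<in> borel_measurable M"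
    and INF_integral: "(INF i\<in>I. \<integral>\<^sup>+x. f i x \<partial>M) = 0"
  shows "AE x in M. (INF i\<in>I. f i x) = 0"
proof -
  have [measurable]: "(\<lambda>x. INF i\<in>I. f i x) \<in> borel_measurable M"
    using I by (intro borel_measurable_INF) auto
  have "(\<integral>\<^sup>+x. (INF i\<in>I. f i x) \<partial>M) \<le> (INF i\<in>I. \<integral>\<^sup>+x. f i x \<partial>M)"
    by (intro INF_greatest nn_integral_mono INF_lower)
  then show ?thesis using INF_integral by (simp add: nn_integral_0_iff_AE)
qed

subsection \<open>Grid intervals and blocks\<close>

definition grid_floor :: "nat \<Rightarrow> real \<Rightarrow> real" where
  "grid_floor k x = of_int \<lfloor>x * real k\<rfloor> / real k"

definition block :: "nat \<Rightarrow> nat \<Rightarrow> nat \<Rightarrow> nat" where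
  "block m k v = v div (m div k)"

lemma block_less:
  assumes "k dvd m" "v < m" shows "block m k v < k"
proof -
  obtain q where "m = k * q" using assms(1) ..
  with assms(2) show ?thesis by (cases "k = 0") (auto simp: block_def less_mult_imp_div_less mult.commute)
qed

lemma block_block:
  assumes "k dvd m" "m dvd l" "0 < l"
  shows "block m k (block l m v) = block l k v"
proof -
  obtain q r where "m = k * q" "l = k * q * r" using assms by (auto simp: dvd_def)
  with assms(3) show ?thesis by (simp add: block_def mult.commute flip: div_mult2_eq)
qed

lemma block_eq_iff:
  assumes "k dvd m" "0 < m"
  shows "block m k v = i \<longleftrightarrow> (m div k) * i \<le> v \<and> v < (m div k) * Suc i"
proof -
  have "0 < m div k" using assms by (auto elim: dvdE)
  then show ?thesis
    unfolding block_def by (auto intro!: div_nat_eqI simp: dividend_less_times_div)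
qed

lemma card_block_fiber:
  assumes "k dvd m" "0 < m" "i < k"
  shows "card {v. v < m \<and> block m k v = i} = m div k"
proof -
  have "(m div k) * Suc i \<le> (m div k) * k" using assms(3) by (intro mult_left_mono) auto
  then have "{v. v < m \<and> block m k v = i} = {(m div k) * i..<(m div k) * Suc i}"
    using assms by (auto simp: block_eq_iff)
  then show ?thesis by simp
qed

lemma equipartition_block:
  assumes "k dvd m" "0 < m" shows "equipartition (m div k) k (block m k)"
  using assms by (auto simp: equipartition_def card_block_fiber block_less)

definition fiber_union :: "nat \<Rightarrow> (nat \<Rightarrow> nat) \<Rightarrow> nat \<Rightarrow> real set" where
  "fiber_union m f i = (\<Union>v\<in>{v. v < m \<and> f v = i}. Ik m v)"

lemma Ik_iff_floor: "0 < k \<Longrightarrow> x \<in> Ik k i \<longleftrightarrow> \<lfloor>x * real k\<rfloor> = int i"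
  by (auto simp: Ik_def floor_eq_iff field_simps)

lemma Ik_iff_grid_floor: "0 < k \<Longrightarrow> x \<in> Ik k i \<longleftrightarrow> grid_floor k x = real i / real k"
  by (simp add: Ik_iff_floor grid_floor_def) (metis of_int_eq_iff of_int_of_nat_eq)

lemma Ik_disjoint: "0 < k \<Longrightarrow> i \<noteq> j \<Longrightarrow> Ik k i \<inter> Ik k j = {}"
  by (auto simp: Ik_iff_floor)

lemma UN_Ik: "0 < k \<Longrightarrow> (\<Union>i<k. Ik k i) = {0..<1}"
proof (intro equalityI subsetI)
  fix x :: real assume k: "0 < k" and x: "x \<in> {0..<1}"
  then have "x * real k < real k" by simp
  with x k show "x \<in> (\<Union>i<k. Ik k i)"
    by (intro UN_I[of "nat \<lfloor>x * real k\<rfloor>"]) (auto simp: Ik_iff_floor nat_less_iff floor_less_iff)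
next
  fix x assume "0 < k" "x \<in> (\<Union>i<k. Ik k i)"
  then obtain i where i: "i < k" "real i \<le> x * real k" "x * real k < real i + 1"
    by (auto simp: Ik_iff_floor floor_eq_iff)
  then have "real i + 1 \<le> real k" by linarith
  with i have "0 \<le> x * real k" "x * real k < 1 * real k" by linarith+
  with i(1) show "x \<in> {0..<1}" by (auto simp: zero_le_mult_iff)
qed

lemma fiber_union_disjoint:
  assumes "i \<noteq> j" shows "fiber_union m f i \<inter> fiber_union m f j = {}"
proof -
  have "f v = f u" if "v < m" "x \<in> Ik m v" "x \<in> Ik m u" for v u x
    using that Ik_disjoint[of m v u] by (cases "v = u") auto
  with assms show ?thesis unfolding fiber_union_def by blast
qed

lemma Ik_subset: "i < k \<Longrightarrow> Ik k i \<subseteq> {0..<1}"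
  using UN_Ik[of k] by auto

lemma floor_mult_dvd:
  assumes "k dvd m" "0 < m"
  shows "\<lfloor>x * real k\<rfloor> = \<lfloor>x * real m\<rfloor> div int (m div k)"
proof -
  obtain q where "m = k * q" using assms(1) ..
  then show ?thesis
    using assms(2) floor_divide_real_eq_div[of "int q" "x * real m"] by simp
qed

lemma Ik_block:
  assumes "k dvd m" "0 < m" "x \<in> Ik m v" shows "x \<in> Ik k (block m k v)"
  using assms by (auto simp: Ik_iff_floor floor_mult_dvd block_def zdiv_int dvd_pos_nat)

lemma fiber_union_block:
  assumes "k dvd m" "0 < m" "i < k"
  shows "fiber_union m (block m k) i = Ik k i"
proof (intro equalityI subsetI)
  fix x assume x: "x \<in> Ik k i"
  then obtain v where v: "v < m" "x \<in> Ik m v"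
    using Ik_subset[OF assms(3)] UN_Ik[OF assms(2)] by blast
  have "block m k v = i"
    using Ik_disjoint[of k i "block m k v"] Ik_block[OF assms(1,2) v(2)] x assms(3) by auto
  with v show "x \<in> fiber_union m (block m k) i" unfolding fiber_union_def by blast
qed (use Ik_block[OF assms(1,2)] in \<open>auto simp: fiber_union_def\<close>)

lemma grid_floor_grid_floor:
  assumes "k dvd m" "0 < m" shows "grid_floor k (grid_floor m x) = grid_floor k x"
  unfolding grid_floor_def floor_mult_dvd[OF assms] using assms by simp

lemma inverse_fact_tendsto_0: "(\<lambda>n. 1 / (fact n :: real)) \<longlonglongrightarrow> 0"
  using summable_LIMSEQ_zero[OF summable_exp[of "1::real"]] by (simp add: inverse_eq_divide)

lemma grid_floor_fact_tendsto: "(\<lambda>n. grid_floor (fact n) x) \<longlonglongrightarrow> x"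
proof -
  have "\<bar>grid_floor (fact n) x - x\<bar> \<le> 1 / fact n" for n
  proof -
    have "of_int \<lfloor>x * fact n\<rfloor> \<le> x * fact n" "x * fact n \<le> of_int \<lfloor>x * fact n\<rfloor> + 1" by linarith+
    then have "grid_floor (fact n) x \<le> x" "x \<le> grid_floor (fact n) x + 1 / fact n"
      by (simp_all add: grid_floor_def pos_divide_le_eq pos_le_divide_eq flip: add_divide_distrib)
    then show ?thesis by simp
  qed
  then have "(\<lambda>n. grid_floor (fact n) x - x) \<longlonglongrightarrow> 0"
    by (intro Lim_null_comparison[OF _ inverse_fact_tendsto_0]) auto
  then show ?thesis by (simp add: LIM_zero_iff)
qed

lemma measurable_grid_floor [measurable]: "grid_floor k \<in> borel_measurable borel"
  unfolding grid_floor_def[abs_def] by measurable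

subsection \<open>Measures on the unit square\<close>

definition coord :: "bool \<Rightarrow> 'a \<times> 'a \<Rightarrow> 'a" where
  "coord b z = (if b then snd z else fst z)"

definition cell :: "nat \<Rightarrow> nat \<times> nat \<Rightarrow> (real \<times> real) set" where
  "cell k c = Ik k (fst c) \<times> Ik k (snd c)"

lemma sets_Leb01: "sets Leb01 = sets (restrict_space borel {0..1})"
  unfolding Leb01_def by (intro sets_restrict_space_cong) simp

lemma space_Leb01: "space Leb01 = {0..1}"
  by (simp add: Leb01_def space_restrict_space)

lemma in_sets_Leb01I: "A \<in> sets borel \<Longrightarrow> A \<subseteq> {0..1} \<Longrightarrow> A \<in> sets Leb01"
  by (simp add: sets_Leb01 sets_restrict_space_iff)

lemma measurable_Leb01_iff:
  "f \<in> measurable M Leb01 \<longleftrightarrow> f \<in> borel_measurable M \<and> f \<in> space M \<rightarrow> {0..1}"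
  using measurable_cong_sets[OF refl sets_Leb01, of M] by (simp add: measurable_restrict_space2_iff conj_commute)

lemma sets_Sq: "sets Sq = sets (Leb01 \<Otimes>\<^sub>M Leb01)"
proof -
  have id_borel: "(\<lambda>x. x) \<in> borel_measurable Leb01"
    by (simp add: measurable_restrict_space1 sets_Leb01 cong: measurable_cong_sets)
  have "(\<lambda>z. (fst z, snd z)) \<in> measurable (Leb01 \<Otimes>\<^sub>M Leb01) (borel \<Otimes>\<^sub>M borel)"
    by (intro measurable_Pair measurable_compose[OF measurable_fst id_borel]
        measurable_compose[OF measurable_snd id_borel])
  then have to_Sq: "(\<lambda>z. z) \<in> measurable (Leb01 \<Otimes>\<^sub>M Leb01) Sq"
    unfolding Sq_def borel_prod
    by (intro measurable_restrict_space2) (auto simp: space_pair_measure space_Leb01)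
  have "fst \<in> measurable Sq Leb01" "snd \<in> measurable Sq Leb01"
    unfolding measurable_Leb01_iff Sq_def borel_prod[symmetric]
    by (auto simp: space_restrict_space intro!: measurable_restrict_space1)
  then have from_Sq: "(\<lambda>z. (fst z, snd z)) \<in> measurable Sq (Leb01 \<Otimes>\<^sub>M Leb01)"
    by (rule measurable_Pair)
  show ?thesis
    using to_Sq from_Sq by (intro sets_eqI_measurable_ident) auto
qed

lemma space_Sq: "space Sq = {0..1} \<times> {0..1}"
  by (simp add: Sq_def space_restrict_space)

lemma Times_in_sets_Sq: "A \<in> sets Leb01 \<Longrightarrow> B \<in> sets Leb01 \<Longrightarrow> A \<times> B \<in> sets Sq"
  unfolding sets_Sq by (rule pair_measureI)

lemma Ik_in_sets_Leb01 [simp]: "i < k \<Longrightarrow> Ik k i \<in> sets Leb01"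
  by (intro in_sets_Leb01I order_trans[OF Ik_subset[of i k]]) (auto simp: Ik_def)

lemma unit_intervals_in_sets_Leb01 [simp]: "{0..1} \<in> sets Leb01" "{0..<1} \<in> sets Leb01"
  by (auto intro!: in_sets_Leb01I)

lemma fiber_union_in_sets_Leb01 [simp]: "fiber_union m f i \<in> sets Leb01"
  unfolding fiber_union_def by (intro sets.finite_UN) auto

lemma cell_in_sets_Sq: "c \<in> grid k \<Longrightarrow> cell k c \<in> sets Sq"
  by (auto simp: cell_def grid_def intro!: Times_in_sets_Sq)

lemma measurable_coord [measurable]: "coord b \<in> measurable Sq Leb01"
  by (cases b) (simp_all add: coord_def[abs_def] cong: measurable_cong_sets add: sets_Sq)

lemma measurable_map_prod_Sq:
  assumes [measurable]: "\<sigma> \<in> measurable Leb01 Leb01"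
  shows "map_prod \<sigma> \<sigma> \<in> measurable Sq Sq"
proof -
  have "(\<lambda>z. (\<sigma> (fst z), \<sigma> (snd z))) \<in> measurable (Leb01 \<Otimes>\<^sub>M Leb01) (Leb01 \<Otimes>\<^sub>M Leb01)" by measurable
  then show ?thesis by (simp add: map_prod_def case_prod_beta' sets_Sq cong: measurable_cong_sets)
qed

lemma prob_algebra_SqD:
  assumes "M \<in> space (prob_algebra Sq)"
  shows "prob_space M" "sets M = sets Sq" "space M = {0..1} \<times> {0..1}"
  using assms sets_eq_imp_space_eq[of M Sq] by (auto simp: space_prob_algebra space_Sq)

lemma cell_disjoint: "0 < k \<Longrightarrow> c \<noteq> c' \<Longrightarrow> cell k c \<inter> cell k c' = {}"
  using Ik_disjoint[of k "fst c" "fst c'"] Ik_disjoint[of k "snd c" "snd c'"]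
  by (auto simp: cell_def prod_eq_iff)

lemma UN_cell: "0 < k \<Longrightarrow> (\<Union>c\<in>grid k. cell k c) = {0..<1} \<times> {0..<1}"
  by (force simp: cell_def grid_def simp flip: UN_Ik)

lemma finite_grid [simp]: "finite (grid k)"
  by (simp add: grid_def)

lemma measure_eq_sum_cells:
  assumes M: "M \<in> space (prob_algebra Sq)" and S: "S \<subseteq> grid k" and T: "T \<in> sets Sq"
    and tiled: "AE z in M. z \<in> T \<longleftrightarrow> (\<exists>c\<in>S. z \<in> cell k c)"
  shows "measure M T = (\<Sum>c\<in>S. Gk k M c)"
proof -
  interpret prob_space M using prob_algebra_SqD(1)[OF M] .
  note [simp] = prob_algebra_SqD(2)[OF M]
  have finite_S: "finite S" using S by (rule finite_subset) simp
  have cells: "cell k ` S \<subseteq> events" using S cell_in_sets_Sq by auto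
  have "measure M T = measure M (\<Union>c\<in>S. cell k c)"
    using tiled T cells finite_S by (intro finite_measure_eq_AE) (auto elim: eventually_mono)
  also have "\<dots> = (\<Sum>c\<in>S. measure M (cell k c))"
  proof (rule finite_measure_finite_Union[OF finite_S cells])
    show "disjoint_family_on (cell k) S"
      using S cell_disjoint[of k] by (cases "k = 0") (auto simp: disjoint_family_on_def grid_def)
  qed
  also have "\<dots> = (\<Sum>c\<in>S. Gk k M c)"
    using S by (intro sum.cong) (auto simp: Gk_def cell_def)
  finally show ?thesis .
qed

subsection \<open>Matrices of masses\<close>

definition partition_matrix :: "nat \<Rightarrow> (nat \<Rightarrow> real set) \<Rightarrow> (real \<times> real) measure \<Rightarrow> nat \<times> nat \<Rightarrow> real" where
  "partition_matrix k B M = (\<lambda>p\<in>grid k. measure M (B (fst p) \<times> B (snd p)))"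

definition coarsen :: "nat \<Rightarrow> nat \<Rightarrow> (nat \<times> nat \<Rightarrow> real) \<Rightarrow> nat \<times> nat \<Rightarrow> real" where
  "coarsen m k = rho m k (block m k)"

definition strip_mass :: "bool \<Rightarrow> nat \<Rightarrow> nat set \<Rightarrow> (nat \<times> nat \<Rightarrow> real) \<Rightarrow> real" where
  "strip_mass b k V X = (\<Sum>c\<in>{c\<in>grid k. coord b c \<in> V}. X c)"

lemma Gk_eq_partition_matrix: "Gk k = partition_matrix k (Ik k)"
  by (simp add: Gk_def partition_matrix_def fun_eq_iff)

lemma measurable_partition_matrix:
  assumes "\<And>i. i < k \<Longrightarrow> B i \<in> sets Leb01"
  shows "partition_matrix k B \<in> measurable (prob_algebra Sq) (MatSpace k)"
  unfolding partition_matrix_def[abs_def] MatSpace_def using assms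
  by (intro measurable_restrict measurable_measure_prob_algebra Times_in_sets_Sq) (auto simp: grid_def)

lemma measurable_Gk [measurable]: "Gk k \<in> measurable (prob_algebra Sq) (MatSpace k)"
  unfolding Gk_eq_partition_matrix by (intro measurable_partition_matrix) simp

lemma measurable_entry: "c \<in> grid k \<Longrightarrow> (\<lambda>X. X c) \<in> borel_measurable (MatSpace k)"
  unfolding MatSpace_def by (rule measurable_component_singleton)

lemma measurable_MatSpace_borel: "(\<lambda>X. X) \<in> measurable (MatSpace k) borel"
proof (rule measurable_coordinatewise_then_product)
  show "(\<lambda>X. X c) \<in> borel_measurable (MatSpace k)" for c
  proof (cases "c \<in> grid k")
    case False
    then have "X c = undefined" if "X \<in> space (MatSpace k)" for X
      using that by (auto simp: MatSpace_def space_PiM)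
    then show ?thesis by (subst measurable_cong[where g = "\<lambda>_. undefined"]) auto
  qed (rule measurable_entry)
qed

lemma measurable_restrict_MatSpace: "(\<lambda>X. restrict X (grid k)) \<in> measurable borel (MatSpace k)"
  unfolding MatSpace_def by (intro measurable_restrict) auto

lemma distr_borel_restrict:
  assumes M: "sets M = sets (MatSpace k)"
  shows "distr (distr M borel (\<lambda>X. X)) (MatSpace k) (\<lambda>X. restrict X (grid k)) = M"
proof -
  have "(\<lambda>X. X) \<in> measurable M borel"
    using measurable_MatSpace_borel by (simp cong: measurable_cong_sets add: M)
  then have "distr (distr M borel (\<lambda>X. X)) (MatSpace k) (\<lambda>X. restrict X (grid k))
      = distr M (MatSpace k) (\<lambda>X. restrict X (grid k))"
    by (simp add: distr_distr measurable_restrict_MatSpace comp_def)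
  also have "\<dots> = distr M M (\<lambda>X. X)"
    using sets_eq_imp_space_eq[OF M] by (intro distr_cong) (auto simp: M MatSpace_def space_PiM)
  finally show ?thesis by (simp add: distr_id)
qed

lemma rho_eq_sum:
  "rho m k f X p = (if p \<in> grid k then \<Sum>c\<in>{c\<in>grid m. map_prod f f c = p}. X c else undefined)"
proof -
  have "{v\<in>{..<m}. f v = fst p} \<times> {u\<in>{..<m}. f u = snd p} = {c\<in>grid m. map_prod f f c = p}"
    by (auto simp: grid_def)
  then show ?thesis by (simp add: rho_def sum.cartesian_product case_prod_beta')
qed

lemma measurable_rho [measurable]: "rho m k f \<in> measurable (MatSpace m) (MatSpace k)"
proof -
  have "rho m k f = (\<lambda>X. \<lambda>p\<in>grid k. \<Sum>c\<in>{c\<in>grid m. map_prod f f c = p}. X c)"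
    by (auto simp: fun_eq_iff rho_eq_sum)
  then show ?thesis
    using measurable_entry[of _ m] unfolding MatSpace_def
    by (auto intro!: measurable_restrict borel_measurable_sum)
qed

lemma measurable_coarsen [measurable]: "coarsen m k \<in> measurable (MatSpace m) (MatSpace k)"
  unfolding coarsen_def by measurable

lemma sum_rho:
  assumes f: "f \<in> {..<m} \<rightarrow> {..<k}"
  shows "(\<Sum>p\<in>{p\<in>grid k. R p}. rho m k f X p) = (\<Sum>c\<in>{c\<in>grid m. R (map_prod f f c)}. X c)"
proof -
  have "(\<Sum>p\<in>{p\<in>grid k. R p}. rho m k f X p)
      = (\<Sum>p\<in>{p\<in>grid k. R p}. \<Sum>c\<in>{c\<in>{c\<in>grid m. R (map_prod f f c)}. map_prod f f c = p}. X c)"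
    by (intro sum.cong refl) (auto simp: rho_eq_sum intro!: sum.cong)
  also have "\<dots> = (\<Sum>c\<in>{c\<in>grid m. R (map_prod f f c)}. X c)"
    using f by (intro sum.group) (auto simp: grid_def)
  finally show ?thesis .
qed

lemma measurable_strip_mass [measurable]: "strip_mass b k V \<in> borel_measurable (MatSpace k)"
  unfolding strip_mass_def[abs_def] by (intro borel_measurable_sum measurable_entry) auto

lemma rho_rho:
  assumes "f \<in> {..<l} \<rightarrow> {..<m}"
  shows "rho m k g (rho l m f X) = rho l k (g \<circ> f) X"
  using sum_rho[OF assms] by (simp add: fun_eq_iff rho_eq_sum[of m k] rho_eq_sum[of l k] prod.map_comp comp_def)

lemma strip_mass_rho:
  assumes "f \<in> {..<m} \<rightarrow> {..<k}"
  shows "strip_mass b k V (rho m k f X) = strip_mass b m (f -` V) X"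
proof -
  have "coord b (map_prod f f c) = f (coord b c)" for c by (simp add: coord_def)
  then show ?thesis by (simp add: strip_mass_def sum_rho[OF assms])
qed

lemma coarsen_coarsen:
  assumes "k dvd m" "m dvd l" "0 < l"
  shows "coarsen m k (coarsen l m X) = coarsen l k X"
  using assms unfolding coarsen_def
  by (subst rho_rho) (auto simp: block_less block_block comp_def)

lemma rho_Gk:
  assumes M: "M \<in> space (prob_algebra Sq)"
  shows "rho m k f (Gk m M) = partition_matrix k (fiber_union m f) M"
proof -
  let ?C = "fiber_union m f"
  have "z \<in> ?C (fst p) \<times> ?C (snd p) \<longleftrightarrow> (\<exists>c\<in>{c\<in>grid m. map_prod f f c = p}. z \<in> cell m c)" for p z
    by (cases p; cases z) (auto simp: cell_def grid_def fiber_union_def)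
  then have "measure M (?C (fst p) \<times> ?C (snd p)) = (\<Sum>c\<in>{c\<in>grid m. map_prod f f c = p}. Gk m M c)" for p
    by (intro measure_eq_sum_cells[OF M]) (auto intro: Times_in_sets_Sq)
  then show ?thesis by (simp add: fun_eq_iff rho_eq_sum partition_matrix_def)
qed

lemma coarsen_Gk:
  assumes "M \<in> space (prob_algebra Sq)" "k dvd m" "0 < m"
  shows "coarsen m k (Gk m M) = Gk k M"
  unfolding coarsen_def rho_Gk[OF assms(1)]
  using assms by (auto simp: partition_matrix_def Gk_def fun_eq_iff grid_def fiber_union_block)

lemma measure_coord_strip:
  assumes M: "M \<in> space (prob_algebra Sq)" and concentrated: "AE z in M. z \<in> {0..<1} \<times> {0..<1}"
    and v: "v < k"
  shows "measure M (coord b -` Ik k v \<inter> space M) = strip_mass b k {v} (Gk k M)"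
  unfolding strip_mass_def
proof (rule measure_eq_sum_cells[OF M])
  note M_Sq = prob_algebra_SqD[OF M]
  show "coord b -` Ik k v \<inter> space M \<in> sets Sq"
    using measurable_sets[OF measurable_coord Ik_in_sets_Leb01[OF v]] M_Sq by (simp add: space_Sq)
  have k: "0 < k" using v by simp
  show "AE z in M. z \<in> coord b -` Ik k v \<inter> space M \<longleftrightarrow> (\<exists>c\<in>{c\<in>grid k. coord b c \<in> {v}}. z \<in> cell k c)"
    using concentrated AE_space
  proof eventually_elim
    case (elim z)
    then obtain c where c: "c \<in> grid k" "z \<in> cell k c" using UN_cell[OF k] by blast
    have cell_coord: "coord b z \<in> Ik k (coord b c')" if "z \<in> cell k c'" for c'
      using that by (auto simp: cell_def coord_def)
    have "coord b c = v" if "coord b z \<in> Ik k v"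
      using that cell_coord[OF c(2)] Ik_disjoint[OF k, of v "coord b c"] by auto
    with c cell_coord elim(2) show ?case by blast
  qed
qed auto

lemma rho_in_Delta:
  assumes "f \<in> {..<m} \<rightarrow> {..<k}" "X \<in> Delta m" shows "rho m k f X \<in> Delta k"
  using sum_rho[OF assms(1), where R = "\<lambda>_. True" and X = X] assms(2)
  by (auto simp: Delta_def MatSpace_def space_PiM rho_eq_sum intro!: sum_nonneg)

subsection \<open>Lebesgue measure on the unit interval\<close>

lemma emeasure_Leb01: "A \<subseteq> {0..1} \<Longrightarrow> emeasure Leb01 A = emeasure lborel A"
  by (simp add: Leb01_def emeasure_restrict_space)

lemma prob_space_Leb01: "prob_space Leb01"
  by (rule prob_spaceI) (simp add: space_Leb01 emeasure_Leb01)

lemma measure_Leb01_Ik: "i < k \<Longrightarrow> measure Leb01 (Ik k i) = 1 / real k"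
proof -
  assume "i < k"
  then have "emeasure Leb01 (Ik k i) = emeasure lborel (Ik k i)"
    by (intro emeasure_Leb01 order_trans[OF Ik_subset]) auto
  also have "\<dots> = ennreal (1 / real k)"
    by (simp add: Ik_def divide_right_mono flip: diff_divide_distrib)
  finally show ?thesis by (simp add: measure_def)
qed

lemma AE_Leb01: "AE x in Leb01. x \<in> {0..<1}"
proof -
  have "measure Leb01 {0..<1} = 1" using measure_Leb01_Ik[of 0 1] by (simp add: Ik_def)
  then show ?thesis
    by (subst prob_space.prob_eq_1[OF prob_space_Leb01, symmetric]) auto
qed

lemma measure_UN_Ik:
  assumes M: "prob_space M" "sets M = sets Leb01"
    and cells: "\<And>i. i < k \<Longrightarrow> measure M (Ik k i) = 1 / real k" and S: "S \<subseteq> {..<k}"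
  shows "measure M (\<Union>i\<in>S. Ik k i) = real (card S) / real k"
proof -
  interpret prob_space M by fact
  have "measure M (\<Union>i\<in>S. Ik k i) = (\<Sum>i\<in>S. measure M (Ik k i))"
  proof (rule finite_measure_finite_Union)
    show "finite S" using S by (rule finite_subset) simp
    show "disjoint_family_on (Ik k) S"
      using S Ik_disjoint[of k] by (cases "k = 0") (auto simp: disjoint_family_on_def)
  qed (use S M in auto)
  also have "\<dots> = (\<Sum>i\<in>S. 1 / real k)" using S by (intro sum.cong cells) auto
  finally show ?thesis by simp
qed

lemma sets_Leb01_eq_sigma_cylinders:
  "sets Leb01 = sigma_sets {0..1} (cylinders {0..1} (\<lambda>_. borel) (\<lambda>n. grid_floor (fact n)))"
  unfolding sets_Leb01
  by (intro sets_restrict_borel_eq_sigma_cylinders measurable_restrict_space1 measurable_grid_floor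
      grid_floor_fact_tendsto)

lemma measurable_grid_floor_Leb01: "grid_floor k \<in> borel_measurable Leb01"
  using measurable_restrict_space1[OF measurable_grid_floor]
  by (simp add: sets_Leb01 cong: measurable_cong_sets)

lemma emeasure_distr_grid_floor:
  assumes M: "prob_space M" "sets M = sets Leb01" and k: "0 < k"
    and cells: "\<And>i. i < k \<Longrightarrow> measure M (Ik k i) = 1 / real k" and A: "A \<in> sets borel"
  shows "emeasure (distr M borel (grid_floor k)) A
    = ennreal (real (card {i. i < k \<and> real i / real k \<in> A}) / real k)"
proof -
  interpret prob_space M by fact
  let ?S = "{i. i < k \<and> real i / real k \<in> A}"
  have UN: "prob (\<Union>i\<in>S. Ik k i) = real (card S) / real k" if "S \<subseteq> {..<k}" for S
    using M cells that by (rule measure_UN_Ik)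
  have floor_M: "grid_floor k \<in> borel_measurable M"
    using measurable_grid_floor_Leb01 by (simp cong: measurable_cong_sets add: M)
  have preimage: "grid_floor k -` A \<inter> space M \<in> events"
    by (rule measurable_sets[OF floor_M A])
  have UN_events: "(\<Union>i\<in>?S. Ik k i) \<in> events"
    using M(2) by (intro sets.finite_UN) simp_all
  have "prob {0..<1} = 1" using UN[of "{..<k}"] UN_Ik[OF k] k by simp
  then have "AE x in M. x \<in> {0..<1}"
    using M(2) by (subst prob_eq_1[symmetric]) auto
  then have "AE x in M. x \<in> grid_floor k -` A \<inter> space M \<longleftrightarrow> x \<in> (\<Union>i\<in>?S. Ik k i)"
    using AE_space
  proof eventually_elim
    case (elim x)
    then obtain i where i: "i < k" "x \<in> Ik k i" using UN_Ik[OF k] by blast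
    have "x \<in> Ik k j \<longleftrightarrow> j = i" for j using Ik_disjoint[OF k, of i j] i(2) by blast
    moreover have "grid_floor k x = real i / real k" using i(2) k by (simp add: Ik_iff_grid_floor)
    ultimately show ?case using i(1) elim(2) by simp
  qed
  then have "prob (grid_floor k -` A \<inter> space M) = prob (\<Union>i\<in>?S. Ik k i)"
    by (rule finite_measure_eq_AE[OF _ preimage UN_events])
  also have "\<dots> = real (card ?S) / real k" by (rule UN) auto
  finally show ?thesis by (simp add: emeasure_distr[OF floor_M A] emeasure_eq_measure)
qed

lemma eq_Leb01I:
  assumes M: "prob_space M" "sets M = sets Leb01"
    and cells: "\<And>n i. i < fact n \<Longrightarrow> measure M (Ik (fact n) i) = 1 / real (fact n)"
  shows "M = Leb01"
proof (rule measure_eqI_cylinders[where N = "\<lambda>_. borel" and f = "\<lambda>n. grid_floor (fact n)" and \<Omega> = "{0..1}"])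
  show "grid_floor (fact n) \<in> borel_measurable M" for n
    using measurable_grid_floor_Leb01 by (simp cong: measurable_cong_sets add: M)
  show "distr M borel (grid_floor (fact n)) = distr Leb01 borel (grid_floor (fact n))" for n
    using emeasure_distr_grid_floor[OF M fact_gt_zero cells, of n]
      emeasure_distr_grid_floor[OF prob_space_Leb01 refl fact_gt_zero measure_Leb01_Ik, of n]
    by (intro measure_eqI) simp_all
  show "\<exists>g\<in>borel_measurable borel. \<forall>x\<in>{0..1}. grid_floor (fact n) x = g (grid_floor (fact m) x)"
    if "n \<le> m" for n m
    using that by (intro bexI[of _ "grid_floor (fact n)"]) (simp_all add: grid_floor_grid_floor fact_dvd)
  have space_M: "space M = {0..1}" using sets_eq_imp_space_eq[OF M(2)] by (simp add: space_Leb01)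
  have "sets (restrict_space M {0..1}) = sets (restrict_space borel {0..1})"
    using sets_restrict_space_cong[OF M(2)[unfolded sets_Leb01]]
    by (simp add: sets_restrict_restrict_space)
  then show "sets (restrict_space M {0..1})
      = sigma_sets {0..1} (cylinders {0..1} (\<lambda>_. borel) (\<lambda>n. grid_floor (fact n)))"
    using sets_Leb01_eq_sigma_cylinders by (simp only: sets_Leb01)
  show "AE x in M. x \<in> {0..1}" "AE x in Leb01. x \<in> {0..1}"
    using AE_space[of M] AE_space[of Leb01] by (simp_all add: space_M space_Leb01)
  show "finite_measure M" using M(1) by (rule prob_space.finite_measure)
  show "{0..1} \<in> sets M" using sets.top[of M] by (simp add: space_M)
qed (rule M(2))

subsection \<open>Random measures and their cell masses\<close>

lemma Gk_in_Delta_iff: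
  assumes M: "M \<in> space (prob_algebra Sq)" and k: "0 < k"
  shows "Gk k M \<in> Delta k \<longleftrightarrow> (AE z in M. z \<in> {0..<1} \<times> {0..<1})"
proof -
  interpret prob_space M using prob_algebra_SqD(1)[OF M] .
  have sets_M: "sets M = sets Sq" using prob_algebra_SqD(2)[OF M] .
  have unit: "{0..<1} \<times> {0..<1} \<in> sets Sq" by (intro Times_in_sets_Sq) auto
  have "prob ({0..<1} \<times> {0..<1}) = (\<Sum>c\<in>grid k. Gk k M c)"
    using UN_cell[OF k] by (intro measure_eq_sum_cells[OF M _ unit] AE_I2) auto
  moreover have "Gk k M \<in> Delta k \<longleftrightarrow> (\<Sum>c\<in>grid k. Gk k M c) = 1"
    by (auto simp: Delta_def MatSpace_def space_PiM Gk_def)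
  moreover have "prob ({0..<1} \<times> {0..<1}) = 1 \<longleftrightarrow> (AE z in M. z \<in> {0..<1} \<times> {0..<1})"
    using unit sets_M by (intro prob_eq_1) simp
  ultimately show ?thesis by simp
qed

lemma sets_Sq_eq_sigma_cylinders:
  "sets Sq = sigma_sets ({0..1} \<times> {0..1}) (cylinders ({0..1} \<times> {0..1}) (\<lambda>_. borel)
    (\<lambda>n. map_prod (grid_floor (fact n)) (grid_floor (fact n))))"
  unfolding Sq_def
proof (rule sets_restrict_borel_eq_sigma_cylinders[OF measurable_restrict_space1])
  show "map_prod (grid_floor (fact n)) (grid_floor (fact n)) \<in> borel_measurable borel" for n
    unfolding borel_prod[symmetric] map_prod_def case_prod_beta' by measurable
  show "(\<lambda>n. map_prod (grid_floor (fact n)) (grid_floor (fact n)) z) \<longlonglongrightarrow> z" for z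
    using tendsto_Pair[OF grid_floor_fact_tendsto[of "fst z"] grid_floor_fact_tendsto[of "snd z"]]
    by (simp add: map_prod_def case_prod_beta')
qed

lemma measurable_prob_algebra_SqI:
  assumes F: "\<And>w. w \<in> space W \<Longrightarrow> F w \<in> space (prob_algebra Sq)"
    and concentrated: "\<And>w. w \<in> space W \<Longrightarrow> AE z in F w. z \<in> {0..<1} \<times> {0..<1}"
    and Gk: "\<And>n. (\<lambda>w. Gk (fact n) (F w)) \<in> measurable W (MatSpace (fact n))"
  shows "F \<in> measurable W (prob_algebra Sq)"
proof (rule measurable_prob_algebra_generated[OF sets_Sq_eq_sigma_cylinders Int_stable_cylinders])
  let ?floor = "\<lambda>n. map_prod (grid_floor (fact n)) (grid_floor (fact n))"
  have measurable_floor: "?floor n \<in> borel_measurable borel" for n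
    unfolding borel_prod[symmetric] map_prod_def case_prod_beta' by measurable
  then show "\<exists>g\<in>borel_measurable borel. \<forall>z\<in>{0..1} \<times> {0..1}. ?floor n z = g (?floor m z)" if "n \<le> m" for n m
    using that by (intro bexI[of _ "?floor n"]) (auto simp: grid_floor_grid_floor fact_dvd)
  fix X assume "X \<in> cylinders ({0..1} \<times> {0..1}) (\<lambda>_. borel) ?floor"
  then obtain n A where X: "X = ?floor n -` A \<inter> ({0..1} \<times> {0..1})" and A: "A \<in> sets borel"
    by (auto simp: cylinders_def)
  let ?k = "fact n :: nat"
  let ?S = "{c\<in>grid ?k. (real (fst c) / real ?k, real (snd c) / real ?k) \<in> A}"
  have "emeasure (F w) X = ennreal (\<Sum>c\<in>?S. Gk ?k (F w) c)" if w: "w \<in> space W" for w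
  proof -
    have "measure (F w) X = (\<Sum>c\<in>?S. Gk ?k (F w) c)"
    proof (rule measure_eq_sum_cells[OF F[OF w]])
      show "X \<in> sets Sq"
        using measurable_sets[OF measurable_restrict_space1[OF measurable_floor] A]
        by (simp add: X Sq_def space_restrict_space)
      show "AE z in F w. z \<in> X \<longleftrightarrow> (\<exists>c\<in>?S. z \<in> cell ?k c)"
        using concentrated[OF w]
      proof eventually_elim
        case (elim z)
        then obtain c where "c \<in> grid ?k" "z \<in> cell ?k c"
          using UN_cell[OF fact_gt_zero, of n] by blast
        with elim show ?case by (cases z) (auto simp: X cell_def Ik_iff_grid_floor)
      qed
    qed auto
    then show ?thesis
      using prob_algebra_SqD(1)[OF F[OF w]]
      by (simp add: finite_measure.emeasure_eq_measure prob_space.finite_measure)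
  qed
  moreover have "(\<lambda>w. ennreal (\<Sum>c\<in>?S. Gk ?k (F w) c)) \<in> borel_measurable W"
    by (intro measurable_compose[OF _ measurable_ennreal] borel_measurable_sum
        measurable_compose[OF Gk measurable_entry]) auto
  ultimately show "(\<lambda>w. emeasure (F w) X) \<in> borel_measurable W"
    by (simp cong: measurable_cong)
qed (use prob_algebra_SqD[OF F] in \<open>simp_all add: cylinders_subset_Pow\<close>)

lemma Delta_in_sets: "Delta k \<in> sets (MatSpace k)"
  unfolding Delta_def MatSpace_def grid_def by measurable

lemma AE_in_Delta:
  assumes "prob_on_Delta k P" shows "AE X in P. X \<in> Delta k"
  using assms Delta_in_sets[of k] prob_space.AE_in_set_eq_1[of P "Delta k"]
  by (auto simp: prob_on_Delta_def measure_def)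

lemma AE_distr_in_Delta:
  assumes f: "f \<in> measurable P (MatSpace k)" and Delta: "prob_on_Delta k (distr P (MatSpace k) f)"
  shows "AE x in P. f x \<in> Delta k"
  using AE_in_Delta[OF Delta] Delta_in_sets sets.sets_into_space[OF Delta_in_sets]
  by (subst (asm) AE_distr_iff[OF f]) auto

lemma AE_concentrated_if_prob_on_Delta:
  assumes P: "sets P = sets (prob_algebra Sq)" and k: "0 < k"
    and Delta: "prob_on_Delta k (distr P (MatSpace k) (Gk k))"
  shows "AE m in P. AE z in m. z \<in> {0..<1} \<times> {0..<1}"
proof -
  have "Gk k \<in> measurable P (MatSpace k)" by (simp cong: measurable_cong_sets add: P)
  from AE_distr_in_Delta[OF this Delta] show ?thesis
    using AE_space
  proof eventually_elim
    case (elim m)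
    then show ?case using Gk_in_Delta_iff[OF _ k] sets_eq_imp_space_eq[OF P] by simp
  qed
qed

lemma law_eqI_Gk:
  assumes P: "prob_space P" "sets P = sets (prob_algebra Sq)"
    and Q: "sets Q = sets (prob_algebra Sq)"
    and law_P: "\<And>n. distr P (MatSpace (fact n)) (Gk (fact n)) = \<nu> n"
    and law_Q: "\<And>n. distr Q (MatSpace (fact n)) (Gk (fact n)) = \<nu> n"
    and Delta: "prob_on_Delta (fact 0) (\<nu> 0)"
  shows "P = Q"
proof -
  define H where "H = Gk (fact 0) -` Delta (fact 0) \<inter> space (prob_algebra Sq)"
  have H_meas: "H \<in> sets (prob_algebra Sq)"
    unfolding H_def by (rule measurable_sets[OF measurable_Gk Delta_in_sets])
  have H_iff: "m \<in> H \<longleftrightarrow> m \<in> space (prob_algebra Sq) \<and> (AE z in m. z \<in> {0..<1} \<times> {0..<1})" for m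
    using Gk_in_Delta_iff[of m "fact 0"] by (auto simp: H_def)
  have AE_H: "AE m in R. m \<in> H"
    if "sets R = sets (prob_algebra Sq)" "distr R (MatSpace (fact 0)) (Gk (fact 0)) = \<nu> 0" for R
    using AE_concentrated_if_prob_on_Delta[of R "fact 0"] that Delta AE_space[of R] sets_eq_imp_space_eq[OF that(1)]
    by (auto simp: H_iff)
  have generator: "sets (restrict_space (prob_algebra Sq) H)
      = sigma_sets H (cylinders H (\<lambda>n. MatSpace (fact n)) (\<lambda>n. Gk (fact n)))"
  proof (rule sets_eq_sigma_cylindersI)
    have "(\<lambda>m. m) \<in> measurable (sigma H (cylinders H (\<lambda>n. MatSpace (fact n)) (\<lambda>n. Gk (fact n))))
        (prob_algebra Sq)"
      by (intro measurable_prob_algebra_SqI measurable_sigma_cylinders)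
        (use H_iff measurable_space[OF measurable_Gk] in \<open>auto simp: space_measure_of_conv\<close>)
    then show "(\<lambda>m. m) \<in> measurable (sigma H (cylinders H (\<lambda>n. MatSpace (fact n)) (\<lambda>n. Gk (fact n))))
        (restrict_space (prob_algebra Sq) H)"
      by (intro measurable_restrict_space2) (auto simp: space_measure_of_conv)
  qed (use H_meas sets.sets_into_space[OF H_meas] in \<open>auto simp: space_restrict_space intro: measurable_restrict_space1\<close>)
  show ?thesis
  proof (rule measure_eqI_cylinders[where \<Omega> = H])
    show "sets (restrict_space P H) = sigma_sets H (cylinders H (\<lambda>n. MatSpace (fact n)) (\<lambda>n. Gk (fact n)))"
      using generator sets_restrict_space_cong[OF P(2)] by simp
    show "\<exists>g\<in>measurable (MatSpace (fact m)) (MatSpace (fact n)). \<forall>M\<in>H. Gk (fact n) M = g (Gk (fact m) M)"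
      if "n \<le> m" for n m
      using that H_iff
      by (intro bexI[of _ "coarsen (fact m) (fact n)"]) (auto simp: coarsen_Gk fact_dvd)
    show "Gk (fact n) \<in> measurable P (MatSpace (fact n))" for n
      by (simp cong: measurable_cong_sets add: P)
    show "AE m in P. m \<in> H" "AE m in Q. m \<in> H"
      by (rule AE_H[OF P(2) law_P], rule AE_H[OF Q law_Q])
  qed (use P Q H_meas law_P law_Q in \<open>auto intro: prob_space.finite_measure\<close>)
qed

subsection \<open>Approximating partitions by equipartitions\<close>

lemma exists_map_with_fiber_cards:
  fixes a :: "nat \<Rightarrow> nat"
  assumes T: "finite T" and card_T: "card T = (\<Sum>i<k. a i)"
  obtains f where "f \<in> T \<rightarrow> {..<k}" "\<And>i. i < k \<Longrightarrow> card {v\<in>T. f v = i} = a i"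
proof -
  let ?S = "SIGMA i:{..<k}. {..<a i}"
  obtain h where h: "bij_betw h T ?S"
    using finite_same_card_bij[of T ?S] T card_T by auto
  show ?thesis
  proof (rule that[of "fst \<circ> h"])
    show "fst \<circ> h \<in> T \<rightarrow> {..<k}" using bij_betwE[OF h] by fastforce
    fix i assume i: "i < k"
    let ?F = "{v\<in>T. (fst \<circ> h) v = i}"
    have "h ` ?F = {p\<in>h ` T. fst p = i}" by auto
    also have "\<dots> = {i} \<times> {..<a i}" using i bij_betw_imp_surj_on[OF h] by auto
    finally show "card ?F = a i"
      using h card_image[of h ?F] by (auto simp: bij_betw_def inj_on_def)
  qed
qed

lemma equipartition_extending:
  assumes disj: "disjoint_family_on E {..<k}" and E: "\<And>i. i < k \<Longrightarrow> E i \<subseteq> {..<q * k}"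
    and card_E: "\<And>i. i < k \<Longrightarrow> card (E i) \<le> q"
  obtains d where "equipartition q k d" "\<And>i v. i < k \<Longrightarrow> v \<in> E i \<Longrightarrow> d v = i"
proof -
  define T where "T = {..<q * k} - (\<Union>i<k. E i)"
  have fin_E: "finite (E i)" if "i < k" for i using E[OF that] by (rule finite_subset) simp
  have "card (\<Union>i<k. E i) = (\<Sum>i<k. card (E i))"
    using disj fin_E by (intro card_UN_disjoint) (auto simp: disjoint_family_on_def)
  moreover have "card T = q * k - card (\<Union>i<k. E i)"
    unfolding T_def using E fin_E by (subst card_Diff_subset) auto
  moreover have "(\<Sum>i<k. q - card (E i)) + (\<Sum>i<k. card (E i)) = q * k"
    using card_E by (subst sum.distrib[symmetric]) (simp add: mult.commute)
  ultimately have "card T = (\<Sum>i<k. q - card (E i))" by simp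
  then obtain f where f: "f \<in> T \<rightarrow> {..<k}" "\<And>i. i < k \<Longrightarrow> card {v\<in>T. f v = i} = q - card (E i)"
    using exists_map_with_fiber_cards[of T "\<lambda>i. q - card (E i)" k] unfolding T_def by blast
  define d where "d v = (if v \<in> T then f v else THE i. i < k \<and> v \<in> E i)" for v
  have d_E: "d v = i" if "i < k" "v \<in> E i" for i v
    using that disj by (auto simp: d_def T_def disjoint_family_on_def)
  have d_T: "d v = f v" if "v \<in> T" for v using that by (simp add: d_def)
  have covered: "v < q * k \<longleftrightarrow> v \<in> T \<or> (\<exists>i<k. v \<in> E i)" for v using E by (auto simp: T_def)
  have "card {v. v < q * k \<and> d v = i} = q" if i: "i < k" for i
  proof -
    let ?F = "{v\<in>T. f v = i}"
    have disjoint: "E i \<inter> T = {}" using i by (auto simp: T_def)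
    then have "v \<in> {v. v < q * k \<and> d v = i} \<longleftrightarrow> v \<in> E i \<union> ?F" for v
      using i d_E d_T[of v] covered by (cases "v \<in> T") auto
    then have "{v. v < q * k \<and> d v = i} = E i \<union> ?F" by (rule set_eqI)
    moreover have "E i \<inter> ?F = {}" "finite ?F" using disjoint by (auto simp: T_def)
    ultimately show ?thesis using card_E[OF i] fin_E[OF i] f(2)[OF i] by (simp add: card_Un_disjoint)
  qed
  moreover have "d \<in> {..<q * k} \<rightarrow> {..<k}" using d_E d_T f(1) covered by force
  ultimately have "equipartition q k d" by (simp add: equipartition_def)
  then show ?thesis using that d_E by blast
qed

lemma nearest_equipartition:
  assumes disj: "disjoint_family_on E {..<k}" and E: "\<And>i. i < k \<Longrightarrow> E i \<subseteq> {..<q * k}"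
  obtains d where "equipartition q k d"
    "(\<Sum>i<k. card {v\<in>E i. d v \<noteq> i}) \<le> (\<Sum>i<k. q - card (E i))"
proof -
  have fin_E: "finite (E i)" if "i < k" for i using E[OF that] by (rule finite_subset) simp
  have "\<exists>F\<subseteq>E i. card F = min (card (E i)) q" for i
    by (metis obtain_subset_with_card_n min.cobounded1)
  then obtain F where F: "\<And>i. F i \<subseteq> E i" "\<And>i. card (F i) = min (card (E i)) q" by metis
  obtain d where d: "equipartition q k d" "\<And>i v. i < k \<Longrightarrow> v \<in> F i \<Longrightarrow> d v = i"
  proof (rule equipartition_extending[of F k q])
    show "disjoint_family_on F {..<k}" using disj F(1) unfolding disjoint_family_on_def by blast
    show "F i \<subseteq> {..<q * k}" if "i < k" for i using F(1) E[OF that] by blast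
  qed (auto simp: F(2))
  have misplaced: "card {v\<in>E i. d v \<noteq> i} \<le> card (E i) - min (card (E i)) q" if i: "i < k" for i
  proof -
    have "{v\<in>E i. d v \<noteq> i} \<subseteq> E i - F i" using d(2)[OF i] by blast
    then have "card {v\<in>E i. d v \<noteq> i} \<le> card (E i - F i)" using fin_E[OF i] by (intro card_mono) auto
    also have "\<dots> = card (E i) - min (card (E i)) q"
      using F[of i] finite_subset[OF F(1) fin_E[OF i]] by (simp add: card_Diff_subset)
    finally show ?thesis .
  qed
  have "(\<Sum>i<k. card (E i)) = card (\<Union>i<k. E i)"
    using disj fin_E by (intro card_UN_disjoint[symmetric]) (auto simp: disjoint_family_on_def)
  also have "\<dots> \<le> card {..<q * k}" using E by (intro card_mono) auto
  finally have "(\<Sum>i<k. card (E i)) \<le> (\<Sum>i<k. q)" by (simp add: mult.commute)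
  moreover have "(\<Sum>i<k. card (E i)) = (\<Sum>i<k. card (E i) - min (card (E i)) q) + (\<Sum>i<k. min (card (E i)) q)"
    by (simp flip: sum.distrib)
  moreover have "(\<Sum>i<k. q) = (\<Sum>i<k. q - card (E i)) + (\<Sum>i<k. min (card (E i)) q)"
    unfolding sum.distrib[symmetric] by (intro sum.cong) auto
  ultimately have "(\<Sum>i<k. card (E i) - min (card (E i)) q) \<le> (\<Sum>i<k. q - card (E i))" by linarith
  moreover have "(\<Sum>i<k. card {v\<in>E i. d v \<noteq> i}) \<le> (\<Sum>i<k. card (E i) - min (card (E i)) q)"
    using misplaced by (intro sum_mono) auto
  ultimately show ?thesis using that d(1) le_trans by blast
qed

lemma disjoint_compacts_separated:
  fixes K :: "'i \<Rightarrow> 'a::heine_borel set"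
  assumes I: "finite I" and K: "\<And>i. i \<in> I \<Longrightarrow> compact (K i)" and disj: "disjoint_family_on K I"
  obtains r where "0 < r" "\<And>i j x y. i \<in> I \<Longrightarrow> j \<in> I \<Longrightarrow> i \<noteq> j \<Longrightarrow> x \<in> K i \<Longrightarrow> y \<in> K j \<Longrightarrow> r \<le> dist x y"
proof -
  have "\<forall>\<^sub>F r in at_right 0. i \<noteq> j \<longrightarrow> (\<forall>x\<in>K i. \<forall>y\<in>K j. r \<le> dist x y)" if i: "i \<in> I" and j: "j \<in> I" for i j
  proof (cases "i = j")
    case False
    then have "K i \<inter> K j = {}" by (intro disjoint_family_onD[OF disj i j])
    then obtain s where "0 < s" "\<forall>x\<in>K i. \<forall>y\<in>K j. s \<le> dist x y"
      using separate_compact_closed K[OF i] compact_imp_closed[OF K[OF j]] by blast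
    then show ?thesis by (intro eventually_at_rightI[of 0 s]) force+
  qed simp
  then have "\<forall>\<^sub>F r in at_right 0. \<forall>i\<in>I. \<forall>j\<in>I. i \<noteq> j \<longrightarrow> (\<forall>x\<in>K i. \<forall>y\<in>K j. r \<le> dist x y)"
    using I by (simp add: eventually_ball_finite)
  then have "\<forall>\<^sub>F r in at_right (0::real). 0 < r \<and> (\<forall>i\<in>I. \<forall>j\<in>I. i \<noteq> j \<longrightarrow> (\<forall>x\<in>K i. \<forall>y\<in>K j. r \<le> dist x y))"
    using eventually_at_right_less eventually_conj by blast
  from eventually_happens'[OF trivial_limit_at_right_real this] show ?thesis
    using that by (elim exE conjE) simp
qed

lemma Leb01_inner_compact:
  assumes B: "B \<in> sets Leb01" and e: "0 < e"
  obtains K where "compact K" "K \<subseteq> B" "measure Leb01 B - e < measure Leb01 K"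
proof -
  interpret prob_space Leb01 by (rule prob_space_Leb01)
  have B_unit: "B \<subseteq> {0..1}" "B \<in> sets lborel"
    using B sets.sets_into_space[OF B] by (auto simp: sets_Leb01 sets_restrict_space_iff space_Leb01)
  obtain K where K: "closed K" "K \<subseteq> B" "emeasure lebesgue (B - K) < ennreal e"
    by (rule sets_lebesgue_inner_closed[OF sets_completionI_sets[OF B_unit(2)] e])
  have K_Leb: "K \<in> sets Leb01" using K B_unit by (intro in_sets_Leb01I) auto
  have "emeasure Leb01 (B - K) = emeasure lebesgue (B - K)"
    using B_unit K(1) by (subst emeasure_Leb01) auto
  with K(3) have "ennreal (prob (B - K)) < ennreal e" by (simp only: emeasure_eq_measure)
  then have "prob (B - K) < e" by (simp only: ennreal_less_iff[OF measure_nonneg])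
  then have "prob B - e < prob K"
    using finite_measure_Diff[OF B K_Leb K(2)] by simp
  moreover have "K = {0..1} \<inter> K" using K(2) B_unit(1) by blast
  then have "compact K" using compact_Int_closed[OF compact_Icc K(1)] by metis
  ultimately show ?thesis using that K(2) by blast
qed

definition cells_meeting :: "nat \<Rightarrow> real set \<Rightarrow> nat set" where
  "cells_meeting N K = {v. v < N \<and> Ik N v \<inter> K \<noteq> {}}"

lemma cells_meeting_subset: "cells_meeting N K \<subseteq> {..<N}"
  by (auto simp: cells_meeting_def)

lemma finite_cells_meeting [simp]: "finite (cells_meeting N K)"
  using cells_meeting_subset by (rule finite_subset) simp

lemma subset_UN_cells_meeting:
  assumes "0 < N" "K \<subseteq> {0..<1}" shows "K \<subseteq> (\<Union>v\<in>cells_meeting N K. Ik N v)"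
  using assms(2) UN_Ik[OF assms(1)] unfolding cells_meeting_def by blast

lemma measure_Leb01_UN_Ik: "S \<subseteq> {..<N} \<Longrightarrow> measure Leb01 (\<Union>v\<in>S. Ik N v) = real (card S) / real N"
  using prob_space_Leb01 refl measure_Leb01_Ik by (rule measure_UN_Ik)

lemma measure_Leb01_le_card_cells_meeting:
  assumes "0 < N" "K \<subseteq> {0..<1}"
  shows "measure Leb01 K \<le> real (card (cells_meeting N K)) / real N"
proof -
  interpret prob_space Leb01 by (rule prob_space_Leb01)
  have "(\<Union>v\<in>cells_meeting N K. Ik N v) \<in> events"
    by (intro sets.finite_UN) (auto simp: cells_meeting_def)
  with subset_UN_cells_meeting[OF assms] have "prob K \<le> prob (\<Union>v\<in>cells_meeting N K. Ik N v)"
    by (rule finite_measure_mono)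
  then show ?thesis by (simp add: measure_Leb01_UN_Ik[OF cells_meeting_subset])
qed

lemma cells_meeting_disjoint:
  assumes separated: "\<And>x y. x \<in> K \<Longrightarrow> y \<in> K' \<Longrightarrow> 1 / real N \<le> dist x y"
  shows "cells_meeting N K \<inter> cells_meeting N K' = {}"
proof (rule ccontr)
  assume "cells_meeting N K \<inter> cells_meeting N K' \<noteq> {}"
  then obtain v x y where xy: "x \<in> Ik N v" "y \<in> Ik N v" "x \<in> K" "y \<in> K'"
    by (auto simp: cells_meeting_def)
  then have "dist x y < 1 / real N"
    by (auto simp: Ik_def dist_real_def abs_less_iff add_divide_distrib)
  with separated[OF xy(3,4)] show False by simp
qed

lemma equipartition_approximating_separated_sets:
  assumes N: "N = q * k" "0 < N" and \<delta>: "0 \<le> \<delta>"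
    and K: "\<And>i. i < k \<Longrightarrow> K i \<subseteq> {0..<1}"
    and separated: "\<And>i j x y. i < k \<Longrightarrow> j < k \<Longrightarrow> i \<noteq> j \<Longrightarrow> x \<in> K i \<Longrightarrow> y \<in> K j \<Longrightarrow> 1 / real N \<le> dist x y"
    and large: "\<And>i. i < k \<Longrightarrow> 1 / real k - \<delta> \<le> measure Leb01 (K i)"
  obtains d where "equipartition q k d"
    "measure Leb01 (\<Union>i<k. K i - fiber_union N d i) \<le> real k * \<delta>"
proof -
  interpret prob_space Leb01 by (rule prob_space_Leb01)
  define E where "E i = cells_meeting N (K i)" for i
  have E_subset: "E i \<subseteq> {..<N}" for i unfolding E_def by (rule cells_meeting_subset)
  have "disjoint_family_on E {..<k}"
    unfolding disjoint_family_on_def E_def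
    by (intro ballI impI cells_meeting_disjoint separated) auto
  then obtain d where d: "equipartition q k d"
    "(\<Sum>i<k. card {v\<in>E i. d v \<noteq> i}) \<le> (\<Sum>i<k. q - card (E i))"
    by (rule nearest_equipartition[of E k q]) (use E_subset N(1) in auto)
  have deficit: "real (q - card (E i)) \<le> real N * \<delta>" if i: "i < k" for i
  proof -
    have "1 / real k - \<delta> \<le> real (card (E i)) / real N"
      using large[OF i] measure_Leb01_le_card_cells_meeting[OF N(2) K[OF i]] by (simp add: E_def)
    then have "real q \<le> real (card (E i)) + real N * \<delta>" using N by (simp add: field_simps)
    then show ?thesis using \<delta> by (cases "card (E i) \<le> q") (simp_all add: of_nat_diff)
  qed
  let ?W = "\<Union>i<k. {v\<in>E i. d v \<noteq> i}"
  have W_subset: "?W \<subseteq> {..<N}" using E_subset by blast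
  have "K i - fiber_union N d i \<subseteq> (\<Union>v\<in>?W. Ik N v)" if "i < k" for i
    using subset_UN_cells_meeting[OF N(2) K[OF that]] E_subset that by (fastforce simp: fiber_union_def E_def)
  then have "prob (\<Union>i<k. K i - fiber_union N d i) \<le> prob (\<Union>v\<in>?W. Ik N v)"
    using W_subset by (intro finite_measure_mono UN_least sets.finite_UN) (auto simp: E_def)
  also have "\<dots> = real (card ?W) / real N" by (rule measure_Leb01_UN_Ik[OF W_subset])
  also have "real (card ?W) \<le> real (\<Sum>i<k. card {v\<in>E i. d v \<noteq> i})"
    by (intro of_nat_mono card_UN_le) simp
  also have "\<dots> \<le> (\<Sum>i<k. real (q - card (E i)))" using d(2) by (simp flip: of_nat_sum)
  also have "\<dots> \<le> (\<Sum>i<k. real N * \<delta>)" using deficit by (intro sum_mono) auto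
  finally have "prob (\<Union>i<k. K i - fiber_union N d i) \<le> (\<Sum>i<k. real N * \<delta>) / real N"
    by (simp add: divide_right_mono)
  then show ?thesis using that d(1) N(2) by simp
qed

lemma separated_compacts_in_partition:
  fixes k :: nat
  assumes B: "\<And>i. i < k \<Longrightarrow> B i \<in> sets Leb01" and disj: "disjoint_family_on B {..<k}" and \<delta>: "0 < \<delta>"
  obtains K r where "\<And>i. i < k \<Longrightarrow> K i \<in> sets Leb01" "\<And>i. i < k \<Longrightarrow> K i \<subseteq> B i \<inter> {0..<1}"
    "\<And>i. i < k \<Longrightarrow> measure Leb01 (B i) - \<delta> \<le> measure Leb01 (K i)" "0 < r"
    "\<And>i j x y. i < k \<Longrightarrow> j < k \<Longrightarrow> i \<noteq> j \<Longrightarrow> x \<in> K i \<Longrightarrow> y \<in> K j \<Longrightarrow> r \<le> dist x y"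
proof -
  interpret prob_space Leb01 by (rule prob_space_Leb01)
  have "\<exists>K. compact K \<and> K \<subseteq> B i \<inter> {0..<1} \<and> prob (B i) - \<delta> \<le> prob K" if "i < k" for i
  proof -
    have half_open: "B i \<inter> {0..<1} \<in> events" using B[OF that] by (intro sets.Int) simp_all
    have "AE x in Leb01. x \<in> B i \<inter> {0..<1} \<longleftrightarrow> x \<in> B i" using AE_Leb01 by (rule eventually_mono) simp
    then have "prob (B i \<inter> {0..<1}) = prob (B i)"
      by (rule finite_measure_eq_AE[OF _ half_open B[OF that]])
    with Leb01_inner_compact[OF half_open \<delta>] show ?thesis by (metis less_imp_le)
  qed
  then obtain K where K: "\<And>i. i < k \<Longrightarrow> compact (K i)" "\<And>i. i < k \<Longrightarrow> K i \<subseteq> B i \<inter> {0..<1}"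
    "\<And>i. i < k \<Longrightarrow> prob (B i) - \<delta> \<le> prob (K i)" by metis
  have K_disj: "disjoint_family_on K {..<k}"
    using disj K(2) unfolding disjoint_family_on_def by blast
  obtain r where "0 < r"
    "\<And>i j x y. i < k \<Longrightarrow> j < k \<Longrightarrow> i \<noteq> j \<Longrightarrow> x \<in> K i \<Longrightarrow> y \<in> K j \<Longrightarrow> r \<le> dist x y"
    using disjoint_compacts_separated[OF finite_lessThan _ K_disj] K(1) by (metis lessThan_iff)
  moreover have "K i \<in> events" if "i < k" for i
    using K(1,2)[OF that] by (intro in_sets_Leb01I) (auto dest: compact_imp_closed)
  ultimately show ?thesis using that K(2,3) by blast
qed

lemma equipartition_approximation:
  assumes k: "0 < k" and B: "\<And>i. i < k \<Longrightarrow> B i \<in> sets Leb01" "\<And>i. i < k \<Longrightarrow> measure Leb01 (B i) = 1 / real k"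
    and disj: "disjoint_family_on B {..<k}" and \<epsilon>: "0 < \<epsilon>"
  obtains n q d where "fact n = q * k" "equipartition q k d"
    "measure Leb01 ({0..1} - (\<Union>i<k. B i \<inter> fiber_union (fact n) d i)) \<le> \<epsilon>"
proof -
  interpret prob_space Leb01 by (rule prob_space_Leb01)
  define \<delta> where "\<delta> = \<epsilon> / (2 * real k)"
  have \<delta>: "0 < \<delta>" using k \<epsilon> by (simp add: \<delta>_def)
  obtain K r where K: "\<And>i. i < k \<Longrightarrow> K i \<in> events" "\<And>i. i < k \<Longrightarrow> K i \<subseteq> B i \<inter> {0..<1}"
      "\<And>i. i < k \<Longrightarrow> prob (B i) - \<delta> \<le> prob (K i)"
    and r: "0 < r" "\<And>i j x y. i < k \<Longrightarrow> j < k \<Longrightarrow> i \<noteq> j \<Longrightarrow> x \<in> K i \<Longrightarrow> y \<in> K j \<Longrightarrow> r \<le> dist x y"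
    using separated_compacts_in_partition[OF B(1) disj \<delta>] by metis
  have large: "1 / real k - \<delta> \<le> prob (K i)" if "i < k" for i using K(3)[OF that] B(2)[OF that] by simp
  have "\<forall>\<^sub>F n in sequentially. 1 / fact n < r \<and> k \<le> n"
    using order_tendstoD(2)[OF inverse_fact_tendsto_0 r(1)] eventually_ge_at_top by (rule eventually_conj)
  then obtain n where n: "1 / fact n < r" "k \<le> n" by (auto dest: eventually_happens)
  have "k dvd fact n" using k n(2) by (intro dvd_fact) auto
  then obtain q where q: "fact n = q * k" by (metis dvd_div_mult_self)
  let ?missed = "{0..1} - (\<Union>i<k. K i)" and ?misplaced = "\<lambda>d. \<Union>i<k. K i - fiber_union (fact n) d i"
  obtain d where d: "equipartition q k d" "prob (?misplaced d) \<le> real k * \<delta>"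
  proof (rule equipartition_approximating_separated_sets[OF q fact_gt_zero less_imp_le[OF \<delta>], where K = K])
    show "1 / real (fact n) \<le> dist x y" if "i < k" "j < k" "i \<noteq> j" "x \<in> K i" "y \<in> K j" for i j x y
      using r(2)[OF that] n(1) by simp
  qed (use K large in auto)
  have "disjoint_family_on K {..<k}" using disj K(2) unfolding disjoint_family_on_def by blast
  then have "(\<Sum>i<k. prob (K i)) = prob (\<Union>i<k. K i)"
    using K(1) by (intro finite_measure_finite_Union[symmetric]) auto
  with sum_mono[of "{..<k}" "\<lambda>_. 1 / real k - \<delta>" "\<lambda>i. prob (K i)"] large have "prob ?missed \<le> real k * \<delta>"
    using prob_compl[of "\<Union>i<k. K i"] K(1) k by (simp add: space_Leb01 algebra_simps)
  moreover have "prob ({0..1} - (\<Union>i<k. B i \<inter> fiber_union (fact n) d i)) \<le> prob ?missed + prob (?misplaced d)"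
  proof -
    have events: "?missed \<in> events" "?misplaced d \<in> events" using K(1) by (auto intro!: sets.finite_UN)
    have "{0..1} - (\<Union>i<k. B i \<inter> fiber_union (fact n) d i) \<subseteq> ?missed \<union> ?misplaced d" using K(2) by blast
    then show ?thesis
      by (rule order_trans[OF finite_measure_mono[OF _ sets.Un[OF events]] measure_Un_le[OF events]])
  qed
  ultimately show ?thesis using that q d k by (simp add: \<delta>_def)
qed

subsection \<open>Expected margins\<close>

definition margin :: "bool \<Rightarrow> (real \<times> real) measure \<Rightarrow> real measure" where
  "margin b M = distr M Leb01 (coord b)"

lemma measurable_margin [measurable]: "margin b \<in> measurable (prob_algebra Sq) (prob_algebra Leb01)"
  unfolding margin_def[abs_def] by (rule measurable_distr_prob_space[OF measurable_coord])

lemma margin_in_space: "M \<in> space (prob_algebra Sq) \<Longrightarrow> margin b M \<in> space (prob_algebra Leb01)"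
  by (rule measurable_space[OF measurable_margin])

lemma measure_margin:
  assumes "M \<in> space (prob_algebra Sq)" "D \<in> sets Leb01"
  shows "measure (margin b M) D = measure M (coord b -` D \<inter> space M)"
  unfolding margin_def using assms prob_algebra_SqD(2)[OF assms(1)]
  by (intro measure_distr) (simp_all cong: measurable_cong_sets)

lemma dist_partition_matrix_le:
  assumes M: "M \<in> space (prob_algebra Sq)" and D: "D \<in> sets Leb01"
    and B: "\<And>i. i < k \<Longrightarrow> B i \<in> sets Leb01" and C: "\<And>i. i < k \<Longrightarrow> C i \<in> sets Leb01"
    and off_D: "\<And>i. i < k \<Longrightarrow> B i - D = C i - D"
  shows "dist (partition_matrix k B M) (partition_matrix k C M)
    \<le> 2 * (measure (margin False M) D + measure (margin True M) D)"
proof (rule dist_fun_le)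
  interpret prob_space M using prob_algebra_SqD(1)[OF M] .
  note [simp] = prob_algebra_SqD(2)[OF M]
  let ?D = "\<lambda>b. coord b -` D \<inter> space M"
  have D_events: "?D b \<in> events" for b
    using D by (intro measurable_sets[of _ _ Leb01]) (simp_all cong: measurable_cong_sets)
  have rect_le: "prob (X \<times> Y) \<le> prob (X' \<times> Y') + (prob (?D False) + prob (?D True))"
    if "X \<in> sets Leb01" "Y \<in> sets Leb01" "X' \<in> sets Leb01" "Y' \<in> sets Leb01" "X - D = X' - D" "Y - D = Y' - D"
    for X Y X' Y'
  proof -
    have XY: "X \<times> Y \<in> events" "X' \<times> Y' \<in> events" using that by (simp_all add: Times_in_sets_Sq)
    have "X \<times> Y \<subseteq> X' \<times> Y' \<union> (?D False \<union> ?D True)"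
      using that(5,6) sets.sets_into_space[OF XY(1)] by (auto simp: coord_def)
    then have "prob (X \<times> Y) \<le> prob (X' \<times> Y' \<union> (?D False \<union> ?D True))"
      using XY D_events by (intro finite_measure_mono) auto
    also have "\<dots> \<le> prob (X' \<times> Y') + prob (?D False \<union> ?D True)"
      using XY D_events by (intro measure_Un_le) auto
    also have "prob (?D False \<union> ?D True) \<le> prob (?D False) + prob (?D True)"
      using D_events by (intro measure_Un_le)
    finally show ?thesis by simp
  qed
  show "dist (partition_matrix k B M p) (partition_matrix k C M p)
      \<le> measure (margin False M) D + measure (margin True M) D" for p
  proof (cases "p \<in> grid k")
    case True
    then have "fst p < k" "snd p < k" by (auto simp: grid_def)
    with True show ?thesis
      using rect_le[of "B (fst p)" "B (snd p)" "C (fst p)" "C (snd p)"]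
        rect_le[of "C (fst p)" "C (snd p)" "B (fst p)" "B (snd p)"]
      by (simp add: partition_matrix_def dist_real_def abs_le_iff measure_margin[OF M D] B C off_D)
  qed (simp add: partition_matrix_def)
qed

lemma disjoint_families_agree_off:
  assumes "disjoint_family_on B I" "disjoint_family_on C I" "i \<in> I" "B i \<subseteq> \<Omega>" "C i \<subseteq> \<Omega>"
  shows "B i - (\<Omega> - (\<Union>j\<in>I. B j \<inter> C j)) = C i - (\<Omega> - (\<Union>j\<in>I. B j \<inter> C j))"
proof -
  have "x \<in> B i \<longleftrightarrow> x \<in> C i" if "j \<in> I" "x \<in> B j" "x \<in> C j" for x j
    using disjoint_family_onD[OF assms(1,3) that(1)] disjoint_family_onD[OF assms(2,3) that(1)] that
    by (cases "i = j") auto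
  with assms(4,5) show ?thesis by blast
qed

lemma Gk_distr_map_prod:
  assumes \<sigma>: "\<sigma> \<in> measurable Leb01 Leb01" and M: "M \<in> space (prob_algebra Sq)"
  shows "Gk k (distr M Sq (map_prod \<sigma> \<sigma>)) = partition_matrix k (\<lambda>i. \<sigma> -` Ik k i \<inter> {0..1}) M"
proof -
  have "map_prod \<sigma> \<sigma> \<in> measurable M Sq"
    using measurable_map_prod_Sq[OF \<sigma>] by (simp cong: measurable_cong_sets add: prob_algebra_SqD(2)[OF M])
  moreover have "map_prod \<sigma> \<sigma> -` cell k p \<inter> space M
      = (\<sigma> -` Ik k (fst p) \<inter> {0..1}) \<times> (\<sigma> -` Ik k (snd p) \<inter> {0..1})" for p
    by (auto simp: cell_def prob_algebra_SqD(3)[OF M])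
  ultimately have "measure (distr M Sq (map_prod \<sigma> \<sigma>)) (cell k p)
      = measure M ((\<sigma> -` Ik k (fst p) \<inter> {0..1}) \<times> (\<sigma> -` Ik k (snd p) \<inter> {0..1}))" if "p \<in> grid k" for p
    using that by (simp add: measure_distr cell_in_sets_Sq)
  then show ?thesis
    unfolding Gk_def partition_matrix_def cell_def by (intro restrict_ext)
qed

subsection \<open>Consistent models and random measures representing them\<close>

locale consistent_model =
  fixes \<mu> :: "nat \<Rightarrow> (nat \<times> nat \<Rightarrow> real) measure"
  assumes consistent: "equipartition_consistent \<mu>"
begin

lemma prob_on_Delta_\<mu>: "0 < k \<Longrightarrow> prob_on_Delta k (\<mu> k)"
  using consistent by (simp add: equipartition_consistent_def)

lemma prob_space_\<mu>: "0 < k \<Longrightarrow> prob_space (\<mu> k)"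
  using prob_on_Delta_\<mu> by (simp add: prob_on_Delta_def)

lemma sets_\<mu>: "0 < k \<Longrightarrow> sets (\<mu> k) = sets (MatSpace k)"
  using prob_on_Delta_\<mu> by (simp add: prob_on_Delta_def)

lemma distr_rho:
  "equipartition q k d \<Longrightarrow> 0 < q \<Longrightarrow> 0 < k \<Longrightarrow> distr (\<mu> (q * k)) (MatSpace k) (rho (q * k) k d) = \<mu> k"
  using consistent by (simp add: equipartition_consistent_def)

lemma distr_coarsen:
  assumes "k dvd m" "0 < m" shows "distr (\<mu> m) (MatSpace k) (coarsen m k) = \<mu> k"
proof -
  obtain q where "m = k * q" using assms(1) ..
  with distr_rho[OF equipartition_block[OF assms]] assms(2) show ?thesis
    by (simp add: coarsen_def mult.commute)
qed

lemma expected_strip_mass_singleton_eq: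
  assumes u: "u < k" and v: "v < k"
  shows "(\<integral>\<^sup>+X. strip_mass b k {u} X \<partial>\<mu> k) = (\<integral>\<^sup>+X. strip_mass b k {v} X \<partial>\<mu> k)"
proof -
  have k: "0 < k" using u by simp
  \<comment> \<open>Permutations are equipartitions with fibers of size one, so consistency contains joint exchangeability.\<close>
  let ?t = "Transposition.transpose u v"
  have less: "?t x < k \<longleftrightarrow> x < k" for x using u v by (auto simp: Transposition.transpose_def)
  have "{x. x < k \<and> ?t x = i} = {?t i}" if "i < k" for i
    using that less[of i] by (auto simp: Transposition.transpose_eq_iff)
  then have equipartition: "equipartition 1 k ?t" by (auto simp: equipartition_def less)
  have rho_\<mu>: "rho k k ?t \<in> measurable (\<mu> k) (MatSpace k)"
    using measurable_rho by (simp cong: measurable_cong_sets add: sets_\<mu>[OF k])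
  have "(\<integral>\<^sup>+X. strip_mass b k {u} X \<partial>\<mu> k)
      = (\<integral>\<^sup>+X. strip_mass b k {u} X \<partial>distr (\<mu> k) (MatSpace k) (rho k k ?t))"
    using distr_rho[OF equipartition] k by simp
  also have "\<dots> = (\<integral>\<^sup>+X. strip_mass b k {u} (rho k k ?t X) \<partial>\<mu> k)"
    by (intro nn_integral_distr[OF rho_\<mu>]) measurable
  also have "\<dots> = (\<integral>\<^sup>+X. strip_mass b k {v} X \<partial>\<mu> k)"
  proof -
    have "?t -` {u} = {v}" by (auto simp: Transposition.transpose_eq_iff)
    then have "strip_mass b k {u} (rho k k ?t X) = strip_mass b k {v} X" for X
      using less by (subst strip_mass_rho) auto
    then show ?thesis by simp
  qed
  finally show ?thesis .
qed

lemma expected_strip_mass_eq_sum: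
  assumes k: "0 < k" and V: "V \<subseteq> {..<k}"
  shows "(\<integral>\<^sup>+X. strip_mass b k V X \<partial>\<mu> k) = (\<Sum>v\<in>V. \<integral>\<^sup>+X. strip_mass b k {v} X \<partial>\<mu> k)"
proof -
  have finite_V: "finite V" using V by (rule finite_subset) simp
  have "(\<integral>\<^sup>+X. strip_mass b k V X \<partial>\<mu> k) = (\<integral>\<^sup>+X. (\<Sum>v\<in>V. ennreal (strip_mass b k {v} X)) \<partial>\<mu> k)"
  proof (rule nn_integral_cong_AE)
    show "AE X in \<mu> k. ennreal (strip_mass b k V X) = (\<Sum>v\<in>V. ennreal (strip_mass b k {v} X))"
      using AE_in_Delta[OF prob_on_Delta_\<mu>[OF k]]
    proof eventually_elim
      case (elim X)
      have "strip_mass b k V X = (\<Sum>v\<in>V. \<Sum>c\<in>{c\<in>{c\<in>grid k. coord b c \<in> V}. coord b c = v}. X c)"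
        unfolding strip_mass_def using finite_V by (intro sum.group[symmetric]) auto
      also have "\<dots> = (\<Sum>v\<in>V. strip_mass b k {v} X)"
        unfolding strip_mass_def by (intro sum.cong) auto
      finally show ?case
        using elim by (subst sum_ennreal) (auto simp: strip_mass_def Delta_def intro!: sum_nonneg)
    qed
  qed
  also have "\<dots> = (\<Sum>v\<in>V. \<integral>\<^sup>+X. strip_mass b k {v} X \<partial>\<mu> k)"
    by (intro nn_integral_sum) (simp cong: measurable_cong_sets add: sets_\<mu>[OF k])
  finally show ?thesis .
qed

lemma expected_strip_mass:
  assumes k: "0 < k" and V: "V \<subseteq> {..<k}"
  shows "(\<integral>\<^sup>+X. strip_mass b k V X \<partial>\<mu> k) = ennreal (real (card V) / real k)"
proof -
  interpret prob_space "\<mu> k" by (rule prob_space_\<mu>[OF k])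
  define a where "a = (\<integral>\<^sup>+X. strip_mass b k {0} X \<partial>\<mu> k)"
  have sum_a: "(\<integral>\<^sup>+X. strip_mass b k W X \<partial>\<mu> k) = of_nat (card W) * a" if "W \<subseteq> {..<k}" for W
  proof -
    have "(\<Sum>v\<in>W. \<integral>\<^sup>+X. strip_mass b k {v} X \<partial>\<mu> k) = (\<Sum>v\<in>W. a)"
      using that k unfolding a_def by (intro sum.cong expected_strip_mass_singleton_eq) auto
    then show ?thesis by (simp add: expected_strip_mass_eq_sum[OF k that])
  qed
  have "AE X in \<mu> k. strip_mass b k {..<k} X = 1"
    using AE_in_Delta[OF prob_on_Delta_\<mu>[OF k]]
  proof eventually_elim
    case (elim X)
    have "{c\<in>grid k. coord b c \<in> {..<k}} = grid k" by (auto simp: grid_def coord_def)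
    with elim show ?case by (simp add: strip_mass_def Delta_def)
  qed
  then have "(\<integral>\<^sup>+X. strip_mass b k {..<k} X \<partial>\<mu> k) = (\<integral>\<^sup>+X. 1 \<partial>\<mu> k)"
    by (intro nn_integral_cong_AE) auto
  then have "of_nat k * a = 1" using sum_a[of "{..<k}"] by (simp add: emeasure_space_1)
  moreover have "ennreal (1 / real k) * (of_nat k * a) = a"
    using k by (simp add: ennreal_of_nat_eq_real_of_nat mult.assoc[symmetric] flip: ennreal_mult')
  ultimately have "a = ennreal (1 / real k)" by simp
  then show ?thesis
    using sum_a[OF V] by (simp add: ennreal_of_nat_eq_real_of_nat flip: ennreal_mult)
qed

end

locale represented_model = consistent_model + prob_space P for P :: "(real \<times> real) measure measure" +
  assumes sets_P [measurable_cong, simp]: "sets P = sets (prob_algebra Sq)"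
    and law_fact: "distr P (MatSpace (fact n)) (Gk (fact n)) = \<mu> (fact n)"
begin

lemma space_P: "space P = space (prob_algebra Sq)"
  by (rule sets_eq_imp_space_eq) simp

lemma AE_concentrated: "AE m in P. AE z in m. z \<in> {0..<1} \<times> {0..<1}"
  by (rule AE_concentrated_if_prob_on_Delta[OF sets_P, of "fact 0"]) (simp_all only: law_fact prob_on_Delta_\<mu> fact_gt_zero)

lemma measurable_measure_margin:
  assumes "D \<in> sets Leb01" shows "(\<lambda>m. ennreal (measure (margin b m) D)) \<in> borel_measurable P"
  using measurable_compose[OF measurable_margin measurable_measure_prob_algebra[OF assms], of b]
  by (simp cong: measurable_cong_sets)

lemma emeasure_bind_margin:
  assumes D: "D \<in> sets Leb01"
  shows "emeasure (P \<bind> margin b) D = (\<integral>\<^sup>+m. measure (margin b m) D \<partial>P)"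
proof -
  have "margin b \<in> measurable P (subprob_algebra Leb01)"
    by (intro measurable_prob_algebraD) measurable
  then have "emeasure (P \<bind> margin b) D = (\<integral>\<^sup>+m. emeasure (margin b m) D \<partial>P)"
    using D by (rule emeasure_bind[OF not_empty])
  also have "\<dots> = (\<integral>\<^sup>+m. measure (margin b m) D \<partial>P)"
  proof (rule nn_integral_cong)
    fix m assume "m \<in> space P"
    then have "prob_space (margin b m)"
      using margin_in_space[of m b] by (simp add: space_P space_prob_algebra)
    then show "emeasure (margin b m) D = ennreal (measure (margin b m) D)"
      by (intro finite_measure.emeasure_eq_measure prob_space.finite_measure)
  qed
  finally show ?thesis .
qed

lemma bind_margin: "P \<bind> margin b = Leb01"
proof (rule eq_Leb01I)
  have margin: "prob_space (margin b m)" "sets (margin b m) = sets Leb01" if "m \<in> space P" for m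
    using margin_in_space[of m b] that by (simp_all add: space_P space_prob_algebra)
  have "margin b \<in> measurable P (subprob_algebra Leb01)"
    by (intro measurable_prob_algebraD) measurable
  then show "prob_space (P \<bind> margin b)"
    using margin(1) by (intro prob_space_bind AE_I2)
  show "sets (P \<bind> margin b) = sets Leb01"
    using margin(2) not_empty by (rule sets_bind)
  fix n v :: nat assume v: "v < fact n"
  let ?k = "fact n :: nat"
  have "emeasure (P \<bind> margin b) (Ik ?k v) = (\<integral>\<^sup>+m. measure (margin b m) (Ik ?k v) \<partial>P)"
    using v by (intro emeasure_bind_margin) simp
  also have "\<dots> = (\<integral>\<^sup>+m. strip_mass b ?k {v} (Gk ?k m) \<partial>P)"
  proof (rule nn_integral_cong_AE)
    show "AE m in P. ennreal (measure (margin b m) (Ik ?k v)) = ennreal (strip_mass b ?k {v} (Gk ?k m))"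
      using AE_concentrated AE_space
      by eventually_elim (simp add: space_P measure_margin Ik_in_sets_Leb01[OF v] measure_coord_strip v)
  qed
  also have "\<dots> = (\<integral>\<^sup>+X. strip_mass b ?k {v} X \<partial>\<mu> ?k)"
    unfolding law_fact[symmetric] by (intro nn_integral_distr[symmetric]) measurable
  also have "\<dots> = ennreal (1 / real ?k)"
    using v by (subst expected_strip_mass) auto
  finally show "measure (P \<bind> margin b) (Ik ?k v) = 1 / real ?k" by (simp add: measure_def)
qed

lemma nn_integral_margin:
  "D \<in> sets Leb01 \<Longrightarrow> (\<integral>\<^sup>+m. measure (margin b m) D \<partial>P) = ennreal (measure Leb01 D)"
  using emeasure_bind_margin[of D b] prob_space_Leb01
  by (simp add: bind_margin finite_measure.emeasure_eq_measure prob_space.finite_measure)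

lemma nn_integral_dist_partition_matrix_le:
  assumes D: "D \<in> sets Leb01" and B: "\<And>i. i < k \<Longrightarrow> B i \<in> sets Leb01" and C: "\<And>i. i < k \<Longrightarrow> C i \<in> sets Leb01"
    and off_D: "\<And>i. i < k \<Longrightarrow> B i - D = C i - D"
  shows "(\<integral>\<^sup>+m. dist (partition_matrix k B m) (partition_matrix k C m) \<partial>P) \<le> ennreal (4 * measure Leb01 D)"
proof -
  have "(\<integral>\<^sup>+m. dist (partition_matrix k B m) (partition_matrix k C m) \<partial>P)
      \<le> (\<integral>\<^sup>+m. 2 * (ennreal (measure (margin False m) D) + ennreal (measure (margin True m) D)) \<partial>P)"
  proof (rule nn_integral_mono)
    fix m assume "m \<in> space P"
    then have "dist (partition_matrix k B m) (partition_matrix k C m)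
        \<le> 2 * (measure (margin False m) D + measure (margin True m) D)"
      by (intro dist_partition_matrix_le D B C off_D) (simp_all add: space_P)
    from ennreal_leI[OF this]
    show "ennreal (dist (partition_matrix k B m) (partition_matrix k C m))
        \<le> 2 * (ennreal (measure (margin False m) D) + ennreal (measure (margin True m) D))"
      by (simp add: ennreal_plus ennreal_mult' distrib_left)
  qed
  also have "\<dots> = 2 * ((\<integral>\<^sup>+m. measure (margin False m) D \<partial>P) + (\<integral>\<^sup>+m. measure (margin True m) D \<partial>P))"
    using measurable_measure_margin[OF D] by (simp add: nn_integral_cmult nn_integral_add)
  also have "\<dots> = ennreal (4 * measure Leb01 D)"
    by (simp add: nn_integral_margin[OF D] ennreal_mult' flip: ennreal_plus)
  finally show ?thesis .
qed

lemma L1_approximation_by_model: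
  assumes k: "0 < k" and B: "\<And>i. i < k \<Longrightarrow> B i \<in> sets Leb01" "\<And>i. i < k \<Longrightarrow> measure Leb01 (B i) = 1 / real k"
    and disj: "disjoint_family_on B {..<k}" and \<epsilon>: "0 < \<epsilon>"
  obtains Z where "Z \<in> measurable P (MatSpace k)" "distr P (MatSpace k) Z = \<mu> k"
    "(\<integral>\<^sup>+m. dist (partition_matrix k B m) (Z m) \<partial>P) \<le> ennreal \<epsilon>"
proof -
  obtain n q d where q: "fact n = q * k" and d: "equipartition q k d"
    and close: "measure Leb01 ({0..1} - (\<Union>i<k. B i \<inter> fiber_union (fact n) d i)) \<le> \<epsilon> / 4"
    using equipartition_approximation[OF k B disj, of "\<epsilon> / 4"] \<epsilon> by auto
  let ?C = "fiber_union (fact n) d"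
  define D where "D = {0..1} - (\<Union>i<k. B i \<inter> ?C i)"
  define Z where "Z m = rho (fact n) k d (Gk (fact n) m)" for m
  have D_Leb01: "D \<in> sets Leb01"
    unfolding D_def using B(1) by (auto intro!: sets.Diff sets.finite_UN)
  have C_disj: "disjoint_family_on ?C {..<k}" by (simp add: disjoint_family_on_def fiber_union_disjoint)
  have unit: "A \<subseteq> {0..1}" if "A \<in> sets Leb01" for A
    using sets.sets_into_space[OF that] by (simp add: space_Leb01)
  have off_D: "B i - D = ?C i - D" if "i < k" for i
    unfolding D_def using disj C_disj that B(1) by (intro disjoint_families_agree_off unit) auto
  show ?thesis
  proof
    show "Z \<in> measurable P (MatSpace k)" unfolding Z_def by measurable
    have "distr P (MatSpace k) Z
        = distr (distr P (MatSpace (fact n)) (Gk (fact n))) (MatSpace k) (rho (fact n) k d)"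
      by (subst distr_distr) (simp_all add: comp_def Z_def[abs_def])
    also have "\<dots> = distr (\<mu> (q * k)) (MatSpace k) (rho (q * k) k d)"
      by (simp only: law_fact flip: q)
    also have "\<dots> = \<mu> k"
      using d k q fact_gt_zero[of n, where 'a = nat] by (intro distr_rho) (auto intro: Nat.gr0I)
    finally show "distr P (MatSpace k) Z = \<mu> k" .
    have "(\<integral>\<^sup>+m. dist (partition_matrix k B m) (Z m) \<partial>P)
        = (\<integral>\<^sup>+m. dist (partition_matrix k B m) (partition_matrix k ?C m) \<partial>P)"
      by (intro nn_integral_cong) (simp add: Z_def rho_Gk space_P)
    also have "\<dots> \<le> ennreal (4 * measure Leb01 D)"
      using D_Leb01 B(1) off_D by (intro nn_integral_dist_partition_matrix_le) simp_all
    also have "\<dots> \<le> ennreal \<epsilon>" using close by (intro ennreal_leI) (simp add: D_def)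
    finally show "(\<integral>\<^sup>+m. dist (partition_matrix k B m) (Z m) \<partial>P) \<le> ennreal \<epsilon>" .
  qed
qed

lemma distr_partition_matrix:
  assumes k: "0 < k" and B: "\<And>i. i < k \<Longrightarrow> B i \<in> sets Leb01" "\<And>i. i < k \<Longrightarrow> measure Leb01 (B i) = 1 / real k"
    and disj: "disjoint_family_on B {..<k}"
  shows "distr P (MatSpace k) (partition_matrix k B) = \<mu> k"
proof -
  have id_distr: "distr (distr P (MatSpace k) f) borel (\<lambda>X. X) = distr P borel f"
    if "f \<in> measurable P (MatSpace k)" for f
    using distr_distr[OF measurable_MatSpace_borel that] by (simp add: comp_def)
  have B_P: "partition_matrix k B \<in> measurable P (MatSpace k)"
    using measurable_partition_matrix[OF B(1)] by (simp cong: measurable_cong_sets)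
  have "distr P borel (partition_matrix k B) = distr (\<mu> k) borel (\<lambda>X. X)"
  proof (rule distr_eq_if_L1_approx[OF prob_space_axioms measurable_compose[OF B_P measurable_MatSpace_borel]])
    fix \<epsilon> :: real assume "0 < \<epsilon>"
    then obtain Z where Z: "Z \<in> measurable P (MatSpace k)" "distr P (MatSpace k) Z = \<mu> k"
      "(\<integral>\<^sup>+m. dist (partition_matrix k B m) (Z m) \<partial>P) \<le> ennreal \<epsilon>"
      using L1_approximation_by_model[OF k B disj] by blast
    then show "\<exists>Z\<in>borel_measurable P. distr P borel Z = distr (\<mu> k) borel (\<lambda>X. X) \<and>
        (\<integral>\<^sup>+m. dist (partition_matrix k B m) (Z m) \<partial>P) \<le> ennreal \<epsilon>"
      using measurable_compose[OF Z(1) measurable_MatSpace_borel] id_distr[OF Z(1)] by auto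
  qed
  then have law_borel: "distr (distr P (MatSpace k) (partition_matrix k B)) borel (\<lambda>X. X)
      = distr (\<mu> k) borel (\<lambda>X. X)"
    by (simp only: id_distr[OF B_P])
  have "distr P (MatSpace k) (partition_matrix k B)
      = distr (distr (\<mu> k) borel (\<lambda>X. X)) (MatSpace k) (\<lambda>X. restrict X (grid k))"
    unfolding law_borel[symmetric] by (rule distr_borel_restrict[symmetric]) simp
  also have "\<dots> = \<mu> k" by (rule distr_borel_restrict[OF sets_\<mu>[OF k]])
  finally show ?thesis .
qed

lemma distr_Gk: "0 < k \<Longrightarrow> distr P (MatSpace k) (Gk k) = \<mu> k"
  unfolding Gk_eq_partition_matrix
  by (rule distr_partition_matrix) (auto simp: measure_Leb01_Ik disjoint_family_on_def Ik_disjoint)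

lemma distr_partition_matrix_vimage:
  assumes \<sigma>: "mp_bij \<sigma>" and k: "0 < k"
  shows "distr P (MatSpace k) (partition_matrix k (\<lambda>i. \<sigma> -` Ik k i \<inter> {0..1})) = \<mu> k"
proof (rule distr_partition_matrix[OF k])
  have \<sigma>_meas: "\<sigma> \<in> measurable Leb01 Leb01" and \<sigma>_distr: "distr Leb01 Leb01 \<sigma> = Leb01"
    using \<sigma> by (auto simp: mp_bij_def)
  fix i assume i: "i < k"
  show "\<sigma> -` Ik k i \<inter> {0..1} \<in> sets Leb01"
    using measurable_sets[OF \<sigma>_meas Ik_in_sets_Leb01[OF i]] by (simp add: space_Leb01)
  have "measure Leb01 (\<sigma> -` Ik k i \<inter> {0..1}) = measure (distr Leb01 Leb01 \<sigma>) (Ik k i)"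
    using measure_distr[OF \<sigma>_meas Ik_in_sets_Leb01[OF i]] by (simp add: space_Leb01)
  then show "measure Leb01 (\<sigma> -` Ik k i \<inter> {0..1}) = 1 / real k"
    by (simp add: \<sigma>_distr measure_Leb01_Ik[OF i])
qed (use Ik_disjoint[OF k] in \<open>auto simp: disjoint_family_on_def\<close>)

lemma exchangeable: "exchangeable_law P"
  unfolding exchangeable_law_def
proof (intro allI impI)
  fix \<sigma> assume \<sigma>: "mp_bij \<sigma>"
  let ?push = "\<lambda>m. distr m Sq (map_prod \<sigma> \<sigma>)"
  have \<sigma>_meas: "\<sigma> \<in> measurable Leb01 Leb01" using \<sigma> by (simp add: mp_bij_def)
  have push: "?push \<in> measurable P (prob_algebra Sq)"
    using measurable_distr_prob_space[OF measurable_map_prod_Sq[OF \<sigma>_meas]] by (simp cong: measurable_cong_sets)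
  have "distr P (prob_algebra Sq) ?push = P"
  proof (rule law_eqI_Gk[OF _ _ sets_P _ law_fact])
    show "prob_space (distr P (prob_algebra Sq) ?push)" by (rule prob_space_distr[OF push])
    show "distr (distr P (prob_algebra Sq) ?push) (MatSpace (fact n)) (Gk (fact n)) = \<mu> (fact n)" for n
    proof -
      have "distr (distr P (prob_algebra Sq) ?push) (MatSpace (fact n)) (Gk (fact n))
          = distr P (MatSpace (fact n)) (\<lambda>m. Gk (fact n) (?push m))"
        by (subst distr_distr[OF measurable_Gk push]) (simp add: comp_def)
      also have "\<dots> = distr P (MatSpace (fact n)) (partition_matrix (fact n) (\<lambda>i. \<sigma> -` Ik (fact n) i \<inter> {0..1}))"
        by (intro distr_cong refl Gk_distr_map_prod \<sigma>_meas) (simp add: space_P)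
      also have "\<dots> = \<mu> (fact n)" by (rule distr_partition_matrix_vimage[OF \<sigma> fact_gt_zero])
      finally show ?thesis .
    qed
    show "prob_on_Delta (fact 0) (\<mu> (fact 0))" by (rule prob_on_Delta_\<mu>[OF fact_gt_zero])
  qed simp
  then show "distr P (prob_algebra Sq) (\<lambda>m. distr m Sq (\<lambda>(x, y). (\<sigma> x, \<sigma> y))) = P"
    by (simp add: map_prod_def)
qed

end

subsection \<open>Measures with prescribed cell masses\<close>

definition matrix_pmf :: "nat \<Rightarrow> (nat \<times> nat \<Rightarrow> real) \<Rightarrow> (nat \<times> nat) pmf" where
  "matrix_pmf k X = embed_pmf (\<lambda>c. if c \<in> grid k then X c else 0)"

text \<open>A probability measure built from cell masses can lose mass only along these indices: a nested sequence
  of half-open cells that stays at the upper end of its blocks has empty intersection.\<close>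

definition last_in_block :: "nat \<Rightarrow> nat \<Rightarrow> nat set" where
  "last_in_block m k = {v. v < m \<and> m div k dvd Suc v}"

definition border_mass :: "bool \<Rightarrow> nat \<Rightarrow> nat \<Rightarrow> (nat \<times> nat \<Rightarrow> real) \<Rightarrow> real" where
  "border_mass b m k X = strip_mass b m (last_in_block m k) X"

lemma pmf_matrix_pmf:
  assumes "X \<in> Delta k" shows "pmf (matrix_pmf k X) c = (if c \<in> grid k then X c else 0)"
  unfolding matrix_pmf_def
proof (rule pmf_embed_pmf)
  have "(\<integral>\<^sup>+c. ennreal (if c \<in> grid k then X c else 0) \<partial>count_space UNIV) = (\<integral>\<^sup>+c. ennreal (X c) \<partial>count_space (grid k))"
    by (subst nn_integral_count_space_indicator[of "grid k"])
      (auto intro!: nn_integral_cong simp: indicator_def)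
  also have "\<dots> = ennreal (\<Sum>c\<in>grid k. X c)"
    using assms by (simp add: nn_integral_count_space_finite sum_ennreal Delta_def)
  finally show "(\<integral>\<^sup>+c. ennreal (if c \<in> grid k then X c else 0) \<partial>count_space UNIV) = 1"
    using assms by (simp add: Delta_def)
qed (use assms in \<open>auto simp: Delta_def\<close>)

lemma measure_matrix_pmf:
  assumes X: "X \<in> Delta k"
  shows "measure (matrix_pmf k X) A = (\<Sum>c\<in>{c\<in>grid k. c \<in> A}. X c)"
proof -
  have "set_pmf (matrix_pmf k X) \<subseteq> grid k"
    by (auto simp: set_pmf_eq pmf_matrix_pmf[OF X] split: if_splits)
  then have "measure (matrix_pmf k X) A = measure (matrix_pmf k X) {c\<in>grid k. c \<in> A}"
    by (intro measure_pmf.finite_measure_eq_AE) (auto simp: AE_measure_pmf_iff)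
  also have "\<dots> = (\<Sum>c\<in>{c\<in>grid k. c \<in> A}. X c)"
    by (simp add: measure_measure_pmf_finite pmf_matrix_pmf[OF X])
  finally show ?thesis .
qed

lemma map_pmf_matrix_pmf:
  assumes f: "f \<in> {..<m} \<rightarrow> {..<k}" and X: "X \<in> Delta m"
  shows "map_pmf (map_prod f f) (matrix_pmf m X) = matrix_pmf k (rho m k f X)"
proof (rule pmf_eqI)
  fix p
  have "pmf (map_pmf (map_prod f f) (matrix_pmf m X)) p = (\<Sum>c\<in>{c\<in>grid m. map_prod f f c = p}. X c)"
    by (simp add: pmf_map measure_matrix_pmf[OF X] vimage_def)
  also have "\<dots> = pmf (matrix_pmf k (rho m k f X)) p"
  proof (cases "p \<in> grid k")
    case False
    then have "(\<Sum>c\<in>{c\<in>grid m. map_prod f f c = p}. X c) = 0"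
      using f by (intro sum.neutral) (auto simp: grid_def)
    with False show ?thesis by (simp add: pmf_matrix_pmf[OF rho_in_Delta[OF f X]])
  qed (simp add: pmf_matrix_pmf[OF rho_in_Delta[OF f X]] rho_eq_sum)
  finally show "pmf (map_pmf (map_prod f f) (matrix_pmf m X)) p = pmf (matrix_pmf k (rho m k f X)) p" .
qed

lemma block_interval_subset:
  assumes km: "k dvd m" "0 < m"
  shows "real (block m k v) / real k \<le> real v / real m"
    and "(real v + 1) / real m \<le> (real (block m k v) + 1) / real k"
    and "v < m \<Longrightarrow> v \<notin> last_in_block m k \<Longrightarrow> (real v + 1) / real m < (real (block m k v) + 1) / real k"
proof -
  define q where "q = m div k"
  have m: "m = q * k" and pos: "0 < q" "0 < k" using km by (auto simp: q_def)
  have bounds: "q * block m k v \<le> v" "Suc v \<le> q * Suc (block m k v)"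
    using block_eq_iff[OF km, of v "block m k v"] by (auto simp: q_def)
  have scale: "a / real k = real q * a / real m" for a using pos by (simp add: m)
  have "real q * real (block m k v) \<le> real v" using bounds(1) by (simp flip: of_nat_mult)
  then show "real (block m k v) / real k \<le> real v / real m"
    unfolding scale by (rule divide_right_mono) simp
  have upper: "real v + 1 \<le> real q * (real (block m k v) + 1)"
    using of_nat_mono[OF bounds(2), where 'a = real] by (simp add: algebra_simps)
  then show "(real v + 1) / real m \<le> (real (block m k v) + 1) / real k"
    unfolding scale by (rule divide_right_mono) simp
  assume "v < m" "v \<notin> last_in_block m k"
  then have "\<not> q dvd Suc v" by (simp add: last_in_block_def q_def)
  then have "Suc v \<noteq> q * Suc (block m k v)" by (metis dvd_triv_left)
  then have "real (Suc v) \<noteq> real (q * Suc (block m k v))" by (metis of_nat_eq_iff)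
  with upper have "real v + 1 < real q * (real (block m k v) + 1)" by (simp add: algebra_simps)
  then show "(real v + 1) / real m < (real (block m k v) + 1) / real k"
    unfolding scale using km(2) by (intro divide_strict_right_mono) auto
qed

lemma lim_nested_blocks_in_Ik:
  fixes a :: "nat \<Rightarrow> nat"
  assumes less: "\<And>n. a n < fact n"
    and nested: "\<And>n m. n \<le> m \<Longrightarrow> a n = block (fact m) (fact n) (a m)"
    and not_last: "\<And>n. \<exists>m\<ge>n. a m \<notin> last_in_block (fact m) (fact n)"
  shows "lim (\<lambda>n. real (a n) / real (fact n)) \<in> Ik (fact n) (a n)"
proof -
  define s where "s n = real (a n) / real (fact n)" for n
  define u where "u n = (real (a n) + 1) / real (fact n)" for n
  note interval = block_interval_subset[OF fact_dvd fact_gt_zero]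
  have s_le: "s n \<le> s m" and u_le: "u m \<le> u n" if "n \<le> m" for n m
    using interval(1,2)[OF that, of "a m"] nested[OF that] by (simp_all only: s_def u_def)
  have s_u: "s n \<le> u m" for n m
  proof -
    have "s n \<le> s (max n m)" "u (max n m) \<le> u m" by (auto intro: s_le u_le)
    moreover have "s (max n m) \<le> u (max n m)" by (simp add: s_def u_def divide_right_mono)
    ultimately show ?thesis by linarith
  qed
  have "incseq s" using s_le by (simp add: incseq_def)
  then obtain l where "s \<longlonglongrightarrow> l"
    by (rule incseq_convergent[of s "u 0"]) (use s_u in auto)
  then have lim_s: "s \<longlonglongrightarrow> lim s" by (simp add: limI)
  have "s n \<le> lim s" by (rule LIMSEQ_le_const[OF lim_s]) (use s_le in blast)
  moreover have "lim s < u n"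
  proof -
    obtain m where m: "n \<le> m" "a m \<notin> last_in_block (fact m) (fact n)" using not_last by blast
    have "lim s \<le> u m" by (rule LIMSEQ_le_const2[OF lim_s]) (use s_u in blast)
    also have "u m < u n"
      using interval(3)[OF m(1) less m(2)] nested[OF m(1)] by (simp only: u_def)
    finally show ?thesis .
  qed
  ultimately show ?thesis by (simp add: Ik_def s_def[abs_def] u_def)
qed

definition limit_point :: "(nat \<Rightarrow> nat \<times> nat) \<Rightarrow> real \<times> real" where
  "limit_point x = (lim (\<lambda>n. real (fst (x n)) / real (fact n)), lim (\<lambda>n. real (snd (x n)) / real (fact n)))"

lemma limit_point_in_cell:
  assumes grid: "\<And>n. x n \<in> grid (fact n)"
    and nested: "\<And>n m. n \<le> m \<Longrightarrow> x n = map_prod (block (fact m) (fact n)) (block (fact m) (fact n)) (x m)"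
    and not_last: "\<And>b n. \<exists>m\<ge>n. coord b (x m) \<notin> last_in_block (fact m) (fact n)"
  shows "limit_point x \<in> cell (fact n) (x n)"
proof -
  have "lim (\<lambda>n. real (coord b (x n)) / real (fact n)) \<in> Ik (fact n) (coord b (x n))" for b
  proof (rule lim_nested_blocks_in_Ik[OF _ _ not_last])
    show "coord b (x n) < fact n" for n using grid[of n] by (auto simp: coord_def grid_def)
    show "coord b (x n) = block (fact m) (fact n) (coord b (x m))" if "n \<le> m" for n m
      using nested[OF that] by (simp add: coord_def)
  qed
  from this[of False] this[of True] show ?thesis
    by (simp add: limit_point_def cell_def coord_def)
qed

lemma measurable_limit_point: "limit_point \<in> borel_measurable (PiM UNIV (\<lambda>_. count_space UNIV))"
proof -
  have "(\<lambda>x. real (g (x n)) / real (fact n)) \<in> borel_measurable (PiM UNIV (\<lambda>_. count_space UNIV))"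
    for g :: "nat \<times> nat \<Rightarrow> nat" and n
    by measurable
  then show ?thesis
    unfolding limit_point_def[abs_def] borel_prod[symmetric]
    by (intro measurable_Pair borel_measurable_lim_metric)
qed

locale cell_masses =
  fixes w :: "nat \<Rightarrow> nat \<times> nat \<Rightarrow> real"
  assumes in_Delta: "w n \<in> Delta (fact n)"
    and coarsen_w: "n \<le> m \<Longrightarrow> coarsen (fact m) (fact n) (w m) = w n"
    and border_mass_vanishes: "(INF m\<in>{n..}. ennreal (border_mass b (fact m) (fact n) (w m))) = 0"

locale random_cell_path = cell_masses w + prob_space L
  for w and L :: "(nat \<Rightarrow> nat \<times> nat) measure" +
  assumes sets_L: "sets L = sets (PiM UNIV (\<lambda>_. count_space UNIV))"
    and law_L: "distr L (count_space UNIV) (\<lambda>x. x n) = matrix_pmf (fact n) (w n)"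
    and nested: "AE x in L. \<forall>n m. n \<le> m \<longrightarrow>
      x n = map_prod (block (fact m) (fact n)) (block (fact m) (fact n)) (x m)"
begin

lemmas measurable_component = measurable_component_UNIV[OF sets_L]

lemma prob_component:
  "prob ((\<lambda>x. x n) -` A \<inter> space L) = (\<Sum>c\<in>{c\<in>grid (fact n). c \<in> A}. w n c)"
  using measure_distr[OF measurable_component, of A n] by (simp add: law_L measure_matrix_pmf[OF in_Delta])

lemma AE_in_grid: "AE x in L. \<forall>n. x n \<in> grid (fact n)"
proof -
  have "AE x in L. x n \<in> grid (fact n)" for n
  proof -
    have "prob ((\<lambda>x. x n) -` grid (fact n) \<inter> space L) = 1"
      using in_Delta[of n] by (simp add: prob_component Delta_def)
    then have "AE x in L. x \<in> (\<lambda>x. x n) -` grid (fact n) \<inter> space L"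
      using measurable_sets[OF measurable_component, of "grid (fact n)" n] by (simp add: prob_eq_1)
    then show ?thesis by (rule eventually_mono) simp
  qed
  then show ?thesis by (simp add: AE_all_countable)
qed

lemma AE_not_last_in_block: "AE x in L. \<exists>m\<ge>n. coord b (x m) \<notin> last_in_block (fact m) (fact n)"
proof -
  let ?A = "\<lambda>m. {c. coord b c \<in> last_in_block (fact m) (fact n)}"
  have "(\<integral>\<^sup>+x. indicator (?A m) (x m) \<partial>L) = ennreal (border_mass b (fact m) (fact n) (w m))" for m
  proof -
    have "(\<integral>\<^sup>+x. indicator (?A m) (x m) \<partial>L) = emeasure (matrix_pmf (fact m) (w m)) (?A m)"
      unfolding law_L[symmetric] by (subst nn_integral_distr[OF measurable_component, symmetric]) auto
    also have "\<dots> = ennreal (border_mass b (fact m) (fact n) (w m))"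
      by (simp add: measure_pmf.emeasure_eq_measure measure_matrix_pmf[OF in_Delta] border_mass_def strip_mass_def)
    finally show ?thesis .
  qed
  then have "AE x in L. (INF m\<in>{n..}. indicator (?A m) (x m) :: ennreal) = 0"
    using border_mass_vanishes[of b n] by (intro AE_INF_eq_0 measurable_compose[OF measurable_component]) auto
  then show ?thesis
  proof eventually_elim
    case (elim x)
    show ?case
    proof (rule ccontr)
      assume "\<not> ?case"
      then have "(INF m\<in>{n..}. indicator (?A m) (x m) :: ennreal) = (INF m\<in>{n..}. 1)"
        by (intro INF_cong) auto
      with elim show False by simp
    qed
  qed
qed

lemma AE_limit_point_in_cell: "AE x in L. \<forall>n. limit_point x \<in> cell (fact n) (x n)"
proof -
  have "AE x in L. \<forall>b n. \<exists>m\<ge>n. coord b (x m) \<notin> last_in_block (fact m) (fact n)"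
    using AE_not_last_in_block by (simp add: AE_all_countable)
  then show ?thesis
    using AE_in_grid nested
  proof eventually_elim
    case (elim x)
    show ?case
      by (rule allI, rule limit_point_in_cell) (use elim in blast)+
  qed
qed

definition path_point :: "(nat \<Rightarrow> nat \<times> nat) \<Rightarrow> real \<times> real" where
  "path_point x = (if limit_point x \<in> {0..1} \<times> {0..1} then limit_point x else (0, 0))"

lemma measurable_path_point: "path_point \<in> measurable L Sq"
proof -
  have [measurable]: "limit_point \<in> borel_measurable L"
    using measurable_limit_point by (simp cong: measurable_cong_sets add: sets_L)
  have [measurable]: "{0..1} \<times> {0..1} \<in> sets (borel :: (real \<times> real) measure)"
    by (intro borel_closed closed_Times) auto
  have "path_point \<in> borel_measurable L"
    unfolding path_point_def[abs_def] by measurable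
  then show ?thesis
    unfolding Sq_def by (intro measurable_restrict_space2) (auto simp: path_point_def)
qed

lemma AE_path_point_in_cell_iff:
  assumes c: "c \<in> grid (fact n)"
  shows "AE x in L. path_point x \<in> cell (fact n) c \<longleftrightarrow> x n = c"
  using AE_limit_point_in_cell AE_in_grid
proof eventually_elim
  case (elim x)
  then have limit: "limit_point x \<in> cell (fact n) (x n)" "x n \<in> grid (fact n)" by blast+
  then have "limit_point x \<in> {0..1} \<times> {0..1}"
    using sets.sets_into_space[OF cell_in_sets_Sq[OF limit(2)]] by (auto simp: space_Sq)
  then have "path_point x = limit_point x" by (simp add: path_point_def)
  with limit(1) cell_disjoint[of "fact n" c "x n"] show ?case by auto
qed

lemma Gk_distr_path_point: "Gk (fact n) (distr L Sq path_point) = w n"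
proof -
  have "measure (distr L Sq path_point) (cell (fact n) c) = w n c" if c: "c \<in> grid (fact n)" for c
  proof -
    note cell = cell_in_sets_Sq[OF c]
    have "prob (path_point -` cell (fact n) c \<inter> space L) = prob ((\<lambda>x. x n) -` {c} \<inter> space L)"
      using AE_path_point_in_cell_iff[OF c] measurable_sets[OF measurable_path_point cell]
        measurable_sets[OF measurable_component, of "{c}" n]
      by (intro finite_measure_eq_AE) auto
    also have "\<dots> = (\<Sum>c'\<in>{c'\<in>grid (fact n). c' \<in> {c}}. w n c')" by (rule prob_component)
    also have "{c'\<in>grid (fact n). c' \<in> {c}} = {c}" using c by auto
    finally show ?thesis by (simp add: measure_distr[OF measurable_path_point cell])
  qed
  moreover have "w n \<in> extensional (grid (fact n))"
    using in_Delta[of n] by (auto simp: Delta_def MatSpace_def space_PiM PiE_def)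
  ultimately show ?thesis
    by (intro ext) (auto simp: Gk_def extensional_def simp flip: cell_def)
qed

end

lemma (in cell_masses) exists_measure: "\<exists>M\<in>space (prob_algebra Sq). \<forall>n. Gk (fact n) M = w n"
proof -
  let ?f = "\<lambda>n m :: nat. map_prod (block (fact m) (fact n)) (block (fact m) (fact n))"
  have "\<exists>L. random_cell_path w L"
  proof (rule pmf_inverse_limit)
    show "?f n m (?f m k c) = ?f n k c" if "n \<le> m" "m \<le> k" for n m k c
      using that by (cases c) (simp add: block_block fact_dvd)
    show "map_pmf (?f n m) (matrix_pmf (fact m) (w m)) = matrix_pmf (fact n) (w n)" if "n \<le> m" for n m
      using coarsen_w[OF that] fact_dvd[OF that, where 'a = nat]
      by (subst map_pmf_matrix_pmf[where k = "fact n", OF _ in_Delta]) (auto simp: block_less coarsen_def)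
  qed (rule exI, intro random_cell_path.intro random_cell_path_axioms.intro cell_masses_axioms, assumption+)
  then obtain L where "random_cell_path w L" ..
  then interpret random_cell_path w L .
  have "distr L Sq path_point \<in> space (prob_algebra Sq)"
    using prob_space_distr[OF measurable_path_point] by (simp add: space_prob_algebra)
  then show ?thesis using Gk_distr_path_point by blast
qed

subsection \<open>Existence\<close>

lemma AE_choice_with_default:
  assumes ex: "AE \<omega> in L. \<exists>y. R \<omega> y"
  obtains F N where "N \<in> null_sets L" "\<And>\<omega>. \<omega> \<in> space L - N \<Longrightarrow> R \<omega> (F \<omega>)"
    "\<And>\<omega>. \<omega> \<notin> space L - N \<Longrightarrow> F \<omega> = d"
proof -
  obtain N where N: "{\<omega>\<in>space L. \<not> (\<exists>y. R \<omega> y)} \<subseteq> N" "emeasure L N = 0" "N \<in> sets L"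
    using ex by (rule AE_E)
  then have "\<forall>\<omega>\<in>space L - N. \<exists>y. R \<omega> y" by blast
  then obtain G where G: "\<forall>\<omega>\<in>space L - N. R \<omega> (G \<omega>)" by (rule bchoice[THEN exE])
  show ?thesis
    by (rule that[of N "\<lambda>\<omega>. if \<omega> \<in> space L - N then G \<omega> else d"]) (use N(2,3) G in auto)
qed

lemma measurable_selection_Gk:
  assumes X: "\<And>n. X n \<in> measurable L (MatSpace (fact n))"
    and ex: "AE \<omega> in L. \<exists>M. M \<in> space (prob_algebra Sq) \<and> (AE z in M. z \<in> {0..<1} \<times> {0..<1}) \<and>
      (\<forall>n. Gk (fact n) M = X n \<omega>)"
  obtains F where "F \<in> measurable L (prob_algebra Sq)" "AE \<omega> in L. \<forall>n. Gk (fact n) (F \<omega>) = X n \<omega>"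
proof -
  obtain F N where N: "N \<in> null_sets L" and F: "\<And>\<omega>. \<omega> \<in> space L - N \<Longrightarrow> F \<omega> \<in> space (prob_algebra Sq) \<and>
      (AE z in F \<omega>. z \<in> {0..<1} \<times> {0..<1}) \<and> (\<forall>n. Gk (fact n) (F \<omega>) = X n \<omega>)"
    and default: "\<And>\<omega>. \<omega> \<notin> space L - N \<Longrightarrow> F \<omega> = return Sq (0, 0)"
    using AE_choice_with_default[OF ex] by metis
  have return: "return Sq (0, 0) \<in> space (prob_algebra Sq)" "AE z in return Sq (0, 0). z \<in> {0..<1} \<times> {0..<1}"
  proof -
    have [measurable]: "{0..<1} \<times> {0..<1} \<in> sets Sq" by (intro Times_in_sets_Sq) auto
    show "AE z in return Sq (0, 0). z \<in> {0..<1} \<times> {0..<1}"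
      by (subst AE_return) (simp_all add: space_Sq)
  qed (simp add: space_prob_algebra space_Sq prob_space_return)
  have "F \<in> measurable L (prob_algebra Sq)"
  proof (rule measurable_prob_algebra_SqI)
    show "F \<omega> \<in> space (prob_algebra Sq)" "AE z in F \<omega>. z \<in> {0..<1} \<times> {0..<1}" for \<omega>
      using F[of \<omega>] return default[of \<omega>] by metis+
    have "Gk (fact n) (F \<omega>) = (if \<omega> \<in> space L - N then X n \<omega> else Gk (fact n) (return Sq (0, 0)))" for n \<omega>
      using F[of \<omega>] default[of \<omega>] by metis
    then show "(\<lambda>\<omega>. Gk (fact n) (F \<omega>)) \<in> measurable L (MatSpace (fact n))" for n
      using X null_setsD2[OF N] measurable_space[OF measurable_Gk return(1)]
      by (simp only:) (intro measurable_If_set, auto)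
  qed
  moreover have "AE \<omega> in L. \<forall>n. Gk (fact n) (F \<omega>) = X n \<omega>"
    using AE_not_in[OF N] AE_space by eventually_elim (use F in blast)
  ultimately show ?thesis by (rule that)
qed

lemma measurable_coarsen_borel: "coarsen m k \<in> borel_measurable borel"
proof (rule measurable_coordinatewise_then_product)
  show "(\<lambda>X. coarsen m k X c) \<in> borel_measurable borel" for c
    by (cases "c \<in> grid k") (auto simp: coarsen_def rho_eq_sum intro!: borel_measurable_sum)
qed

lemma card_last_in_block:
  assumes "k dvd m" "0 < m" shows "card (last_in_block m k) \<le> k"
proof -
  obtain q where q: "m = q * k" "0 < q" "0 < k"
    using assms by (auto elim!: dvdE simp: mult.commute)
  have "last_in_block m k \<subseteq> (\<lambda>j. q * Suc j - 1) ` {..<k}"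
  proof
    fix v assume "v \<in> last_in_block m k"
    then have "q dvd Suc v" "Suc v \<le> q * k" by (auto simp: last_in_block_def q Suc_le_eq)
    then obtain j where "Suc v = q * j" "j \<le> k" using q by (auto elim!: dvdE)
    then show "v \<in> (\<lambda>j. q * Suc j - 1) ` {..<k}"
      by (intro image_eqI[where x = "j - 1"]) (cases j; simp)+
  qed
  then have "card (last_in_block m k) \<le> card ((\<lambda>j. q * Suc j - 1) ` {..<k})"
    by (intro card_mono) auto
  also have "\<dots> \<le> k" using card_image_le[of "{..<k}"] by simp
  finally show ?thesis .
qed

locale random_refinement = consistent_model + prob_space L for L :: "(nat \<Rightarrow> nat \<times> nat \<Rightarrow> real) measure" +
  assumes sets_L: "sets L = sets (PiM UNIV (\<lambda>_. borel))"
    and law_L: "distr L (MatSpace (fact n)) (\<lambda>\<omega>. restrict (\<omega> n) (grid (fact n))) = \<mu> (fact n)"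
    and nested: "AE \<omega> in L. \<forall>n m. n \<le> m \<longrightarrow> \<omega> n = coarsen (fact m) (fact n) (\<omega> m)"

lemma (in consistent_model) random_refinement_exists: "\<exists>L. random_refinement \<mu> L"
proof -
  have id_\<mu>: "(\<lambda>X. X) \<in> measurable (\<mu> (fact n)) borel" for n
    using measurable_MatSpace_borel by (simp cong: measurable_cong_sets add: sets_\<mu>)
  interpret inverse_system "\<lambda>n. distr (\<mu> (fact n)) borel (\<lambda>X. X)" "\<lambda>n m. coarsen (fact m) (fact n)"
  proof (rule inverse_system.intro)
    show "prob_space (distr (\<mu> (fact n)) borel (\<lambda>X. X))" for n
      by (intro prob_space.prob_space_distr[OF prob_space_\<mu>] id_\<mu>) simp
    show "coarsen (fact m) (fact n) (coarsen (fact k) (fact m) X) = coarsen (fact k) (fact n) X"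
      if "n \<le> m" "m \<le> k" for n m k X
      using that by (simp add: coarsen_coarsen fact_dvd)
    fix n m :: nat assume nm: "n \<le> m"
    have coarsen_\<mu>: "coarsen (fact m) (fact n) \<in> measurable (\<mu> (fact m)) (MatSpace (fact n))"
      using measurable_coarsen by (simp cong: measurable_cong_sets add: sets_\<mu>)
    have "distr (distr (\<mu> (fact m)) borel (\<lambda>X. X)) borel (coarsen (fact m) (fact n))
        = distr (distr (\<mu> (fact m)) (MatSpace (fact n)) (coarsen (fact m) (fact n))) borel (\<lambda>X. X)"
      unfolding distr_distr[OF measurable_coarsen_borel id_\<mu>] distr_distr[OF measurable_MatSpace_borel coarsen_\<mu>]
      by (simp add: comp_def)
    then show "distr (distr (\<mu> (fact m)) borel (\<lambda>X. X)) borel (coarsen (fact m) (fact n))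
        = distr (\<mu> (fact n)) borel (\<lambda>X. X)"
      by (simp only: distr_coarsen[OF fact_dvd[OF nm] fact_gt_zero])
  qed (simp_all add: measurable_coarsen_borel)
  have "distr lim (MatSpace (fact n)) (\<lambda>\<omega>. restrict (\<omega> n) (grid (fact n))) = \<mu> (fact n)" for n
    using distr_distr[OF measurable_restrict_MatSpace[of "fact n"] measurable_component_UNIV[OF sets_lim, of n]]
      distr_borel_restrict[OF sets_\<mu>[OF fact_gt_zero], of n]
    by (simp add: distr_lim_component comp_def)
  then have "random_refinement \<mu> lim"
    using AE_lim_consistent
    by (intro random_refinement.intro random_refinement_axioms.intro consistent_model_axioms P.prob_space_axioms) simp_all
  then show ?thesis ..
qed

context random_refinement
begin

abbreviation level :: "nat \<Rightarrow> (nat \<Rightarrow> nat \<times> nat \<Rightarrow> real) \<Rightarrow> nat \<times> nat \<Rightarrow> real" where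
  "level n \<omega> \<equiv> restrict (\<omega> n) (grid (fact n))"

lemma measurable_level: "level n \<in> measurable L (MatSpace (fact n))"
  using measurable_component_UNIV[OF sets_L] measurable_restrict_MatSpace by (rule measurable_compose)

lemma AE_level_in_Delta: "AE \<omega> in L. \<forall>n. level n \<omega> \<in> Delta (fact n)"
proof -
  have "AE \<omega> in L. level n \<omega> \<in> Delta (fact n)" for n
    using prob_on_Delta_\<mu>[OF fact_gt_zero] unfolding law_L[symmetric]
    by (rule AE_distr_in_Delta[OF measurable_level])
  then show ?thesis by (simp add: AE_all_countable)
qed

lemma expected_border_mass_le:
  assumes "n \<le> m"
  shows "(\<integral>\<^sup>+\<omega>. border_mass b (fact m) (fact n) (level m \<omega>) \<partial>L) \<le> ennreal (fact n * (1 / fact m))"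
proof -
  let ?V = "last_in_block (fact m) (fact n)"
  have "(\<integral>\<^sup>+\<omega>. border_mass b (fact m) (fact n) (level m \<omega>) \<partial>L)
      = (\<integral>\<^sup>+X. strip_mass b (fact m) ?V X \<partial>\<mu> (fact m))"
    unfolding law_L[symmetric] border_mass_def
    by (intro nn_integral_distr[OF measurable_level, symmetric]) measurable
  also have "\<dots> = ennreal (real (card ?V) / real (fact m))"
    by (intro expected_strip_mass) (auto simp: last_in_block_def)
  also have "\<dots> \<le> ennreal (fact n * (1 / fact m))"
    using of_nat_mono[OF card_last_in_block[OF fact_dvd[OF assms] fact_gt_zero], where 'a = real]
    by (intro ennreal_leI) (simp add: divide_right_mono)
  finally show ?thesis .
qed

lemma AE_border_mass_vanishes:
  "AE \<omega> in L. \<forall>b n. (INF m\<in>{n..}. ennreal (border_mass b (fact m) (fact n) (level m \<omega>))) = 0"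
proof -
  have "AE \<omega> in L. (INF m\<in>{n..}. ennreal (border_mass b (fact m) (fact n) (level m \<omega>))) = 0" for b n
  proof (rule AE_INF_eq_0)
    show "(\<lambda>\<omega>. ennreal (border_mass b (fact m) (fact n) (level m \<omega>))) \<in> borel_measurable L" for m
      unfolding border_mass_def
      by (intro measurable_compose[OF _ measurable_ennreal] measurable_compose[OF measurable_level] measurable_strip_mass)
    let ?I = "INF m\<in>{n..}. \<integral>\<^sup>+\<omega>. border_mass b (fact m) (fact n) (level m \<omega>) \<partial>L"
    have "?I \<le> ennreal (fact n * (1 / fact m))" if "n \<le> m" for m
      by (rule INF_lower2[where i = m]) (use that expected_border_mass_le in auto)
    moreover have "(\<lambda>m. ennreal (fact n * (1 / fact m))) \<longlonglongrightarrow> ennreal (fact n * 0)"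
      by (intro tendsto_ennrealI tendsto_mult_left inverse_fact_tendsto_0)
    ultimately have "?I \<le> ennreal (fact n * 0)" by (blast intro: LIMSEQ_le_const)
    then show "?I = 0" by simp
  qed simp
  then show ?thesis by (simp add: AE_all_countable)
qed

lemma AE_cell_masses: "AE \<omega> in L. cell_masses (\<lambda>n. level n \<omega>)"
  using AE_level_in_Delta AE_border_mass_vanishes nested
proof eventually_elim
  case (elim \<omega>)
  have level_eq: "level n \<omega> = \<omega> n" for n
  proof -
    have "coarsen (fact n) (fact n) (\<omega> n) \<in> extensional (grid (fact n))"
      by (simp add: coarsen_def rho_def)
    moreover have "coarsen (fact n) (fact n) (\<omega> n) = \<omega> n" using elim(3) by (metis order_refl)
    ultimately show ?thesis by (simp add: extensional_restrict)
  qed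
  show ?case
    using elim unfolding level_eq by (intro cell_masses.intro) auto
qed

lemma represented_model_exists: "\<exists>P. represented_model \<mu> P"
proof -
  have "AE \<omega> in L. \<exists>M. M \<in> space (prob_algebra Sq) \<and> (AE z in M. z \<in> {0..<1} \<times> {0..<1}) \<and>
      (\<forall>n. Gk (fact n) M = level n \<omega>)"
    using AE_cell_masses AE_level_in_Delta
  proof eventually_elim
    case (elim \<omega>)
    then obtain M where M: "M \<in> space (prob_algebra Sq)" "\<forall>n. Gk (fact n) M = level n \<omega>"
      using cell_masses.exists_measure by blast
    moreover have "Gk (fact 0) M \<in> Delta (fact 0)" using M(2) elim(2) by metis
    ultimately show ?case using Gk_in_Delta_iff[OF M(1) fact_gt_zero] by blast
  qed
  then obtain F where F: "F \<in> measurable L (prob_algebra Sq)" "AE \<omega> in L. \<forall>n. Gk (fact n) (F \<omega>) = level n \<omega>"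
    by (rule measurable_selection_Gk[OF measurable_level])
  have "distr (distr L (prob_algebra Sq) F) (MatSpace (fact n)) (Gk (fact n)) = \<mu> (fact n)" for n
  proof -
    have "distr (distr L (prob_algebra Sq) F) (MatSpace (fact n)) (Gk (fact n))
        = distr L (MatSpace (fact n)) (\<lambda>\<omega>. Gk (fact n) (F \<omega>))"
      by (subst distr_distr[OF measurable_Gk F(1)]) (simp add: comp_def)
    also have "\<dots> = distr L (MatSpace (fact n)) (level n)"
      using F(2) by (intro distr_cong_AE measurable_compose[OF F(1) measurable_Gk] measurable_level) auto
    finally show ?thesis by (simp only: law_L)
  qed
  then have "represented_model \<mu> (distr L (prob_algebra Sq) F)"
    using prob_space_distr[OF F(1)] consistent_model_axioms
    by (intro represented_model.intro represented_model_axioms.intro) simp_all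
  then show ?thesis ..
qed

end

theorem mainTheorem19:
  fixes \<mu> :: "nat \<Rightarrow> (nat \<times> nat \<Rightarrow> real) measure"
  assumes "equipartition_consistent \<mu>"
  shows "\<exists>!P :: (real \<times> real) measure measure.
           prob_space P \<and> sets P = sets (prob_algebra Sq) \<and>
           exchangeable_law P \<and>
           (\<forall>k\<ge>1. distr P (MatSpace k) (Gk k) = \<mu> k)"
proof -
  interpret consistent_model \<mu> using assms by (rule consistent_model.intro)
  obtain L where "random_refinement \<mu> L"
    using random_refinement_exists by blast
  then obtain P where "represented_model \<mu> P"
    using random_refinement.represented_model_exists by blast
  then interpret represented_model \<mu> P .
  show ?thesis
  proof (rule ex1I[of _ P])
    show "prob_space P \<and> sets P = sets (prob_algebra Sq) \<and> exchangeable_law P \<and>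
        (\<forall>k\<ge>1. distr P (MatSpace k) (Gk k) = \<mu> k)"
      using prob_space_axioms exchangeable distr_Gk by simp
  next
    fix Q assume Q: "prob_space Q \<and> sets Q = sets (prob_algebra Sq) \<and> exchangeable_law Q \<and>
        (\<forall>k\<ge>1. distr Q (MatSpace k) (Gk k) = \<mu> k)"
    show "Q = P"
      by (rule law_eqI_Gk[OF _ _ sets_P _ law_fact prob_on_Delta_\<mu>]) (use Q in auto)
  qed
qed

end
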